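(* Let $k$ be an algebraically closed field of characteristic $0$. For all integers $n \geq 2$ and $d \geq 2$, the map $\Psi_d^n : \mathcal{M}_d^n \to \mathcal{M}_d^{n+1}$, which sends the class of a smooth hypersurface $Y = V(F) \subseteq \mathbb{P}^{n+1}_k$ of degree $d$ to the class of its $d$-cyclic cover $\widetilde{Y} = V(x_{n+2}^d - F) \subseteq \mathbb{P}^{n+2}_k$, is injective. That is, if $Y_1 = V(F_1)$ and $Y_2 = V(F_2)$ are smooth hypersurfaces of degree $d$ in $\mathbb{P}^{n+1}_k$ such that $V(x_{n+2}^d - F_1)$ and $V(x_{n+2}^d - F_2)$ are projectively equivalent in $\mathbb{P}^{n+2}_k$, then $Y_1$ and $Y_2$ are projectively equivalent in $\mathbb{P}^{n+1}_k$.
   Context: For integers $n, d$, $\mathcal{M}_d^n$ denotes the moduli space of smooth hypersurfaces of degree $d$ in $\mathbb{P}^{n+1}_k$; its points ($k$-points) are the projective equivalence classes of such hypersurfaces. Two hypersurfaces $Y_1, Y_2 \subseteq \mathbb{P}^{m}_k$ are projectively equivalent if there is a linear automorphism $g \in \mathrm{PGL}_{m+1}(k)$ of $\mathbb{P}^m_k$ with $g(Y_1) = Y_2$. If $Y = V(F) \subseteq \mathbb{P}^{n+1}_k$ is a smooth hypersurface defined by a homogeneous polynomial $F \in k[x_0, \ldots, x_{n+1}]$ of degree $d$, its associated $d$-cyclic cover is the hypersurface $\widetilde{Y} = V(x_{n+2}^d - F) \subseteq \mathbb{P}^{n+2}_k$, which is smooth of degree $d$, with the map $\widetilde{Y} \to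 \mathbb{P}^{n+1}_k$ given by projection from the point $[0:\cdots:0:1]$ (forgetting $x_{n+2}$); this map is a cyclic covering of degree $d$ branched along $Y$. The projective equivalence class of $\widetilde{Y}$ depends only on that of $Y$. The map $\Psi_d^n$ is $[Y] \mapsto [\widetilde{Y}]$, and injectivity is meant on points, i.e. on projective equivalence classes. *)

theory Defs
  imports
    "HOL-Library.Poly_Mapping"
    "HOL-Computational_Algebra.Polynomial"
    "Jordan_Normal_Form.Matrix"
begin

text \<open>
  Polynomials in the variables \<open>x\<^sub>0, x\<^sub>1, \<dots>\<close>: finitely supported functions from monomials
  (finitely supported exponent functions) to coefficients, with the convolution product
  of \<^theory>\<open>HOL-Library.Poly_Mapping\<close>.
\<close>

type_synonym 'k mpoly = "(nat \<Rightarrow>\<^sub>0 nat) \<Rightarrow>\<^sub>0 'k"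

definition mvar :: "nat \<Rightarrow> 'k::comm_ring_1 mpoly" where
  "mvar i = Poly_Mapping.single (Poly_Mapping.single i 1) 1"

definition meval :: "'k::comm_ring_1 mpoly \<Rightarrow> 'k vec \<Rightarrow> 'k" where
  "meval F x =
     (\<Sum>a\<in>Poly_Mapping.keys F. Poly_Mapping.lookup F a *
        (\<Prod>i\<in>Poly_Mapping.keys a. (x $ i) ^ Poly_Mapping.lookup a i))"

text \<open>
  Formal partial derivative with respect to \<open>x\<^sub>i\<close>. Subtraction of exponents truncates, but
  it does so only for monomials not involving \<open>x\<^sub>i\<close>, whose new coefficient is \<open>0\<close>.
\<close>

definition mderiv :: "nat \<Rightarrow> 'k::comm_ring_1 mpoly \<Rightarrow> 'k mpoly" where
  "mderiv i F =
     (\<Sum>a\<in>Poly_Mapping.keys F.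
        Poly_Mapping.single (a - Poly_Mapping.single i 1)
          (of_nat (Poly_Mapping.lookup a i) * Poly_Mapping.lookup F a))"

text \<open>Homogeneous of degree \<open>d\<close> in \<open>k[x\<^sub>0, \<dots>, x\<^sub>m]\<close>; the zero polynomial is included.\<close>

definition homogeneous :: "nat \<Rightarrow> nat \<Rightarrow> 'k::comm_ring_1 mpoly \<Rightarrow> bool" where
  "homogeneous m d F \<longleftrightarrow>
     (\<forall>a\<in>Poly_Mapping.keys F.
        Poly_Mapping.keys a \<subseteq> {0..m} \<and>
        (\<Sum>i\<in>Poly_Mapping.keys a. Poly_Mapping.lookup a i) = d)"

text \<open>
  A point of \<open>\<P>\<^sup>m\<close> is a class of nonzero vectors of length \<open>m + 1\<close> modulo scaling,
  i.e. a line through the origin with the origin removed.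
\<close>

definition scaling_rel :: "nat \<Rightarrow> ('k::field vec \<times> 'k vec) set" where
  "scaling_rel m =
     {(x, y). x \<in> carrier_vec (m + 1) - {0\<^sub>v (m + 1)} \<and>
              y \<in> carrier_vec (m + 1) - {0\<^sub>v (m + 1)} \<and>
              (\<exists>c. c \<noteq> 0 \<and> y = c \<cdot>\<^sub>v x)}"

definition proj_space :: "nat \<Rightarrow> 'k::field vec set set" where
  "proj_space m = (carrier_vec (m + 1) - {0\<^sub>v (m + 1)}) // scaling_rel m"

definition zero_locus :: "nat \<Rightarrow> 'k::field mpoly \<Rightarrow> 'k vec set set" where
  "zero_locus m F = {P \<in> proj_space m. \<forall>x\<in>P. meval F x = 0}"

text \<open>
  The forms \<open>F\<close> of degree \<open>d\<close> for which \<open>V(F) \<subseteq> \<P>\<^sup>m\<close> is a smooth hypersurface of degree \<open>d\<close>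
  (Jacobian criterion at every point of \<open>V(F)\<close>).
\<close>

definition smooth_form :: "nat \<Rightarrow> nat \<Rightarrow> 'k::field mpoly \<Rightarrow> bool" where
  "smooth_form m d F \<longleftrightarrow>
     homogeneous m d F \<and> F \<noteq> 0 \<and>
     (\<forall>P\<in>zero_locus m F. \<forall>x\<in>P. \<exists>i\<le>m. meval (mderiv i F) x \<noteq> 0)"

definition smooth_hypersurfaces :: "nat \<Rightarrow> nat \<Rightarrow> 'k::field vec set set set" where
  "smooth_hypersurfaces m d = {zero_locus m F | F. smooth_form m d F}"

text \<open>
  The automorphism of \<open>\<P>\<^sup>m\<close> induced by an invertible matrix of size \<open>m + 1\<close>. It is a map on points,
  so matrices differing by a scalar induce the same element of \<open>PGL\<^bsub>m+1\<^esub>(k)\<close>.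
\<close>

definition proj_map :: "'k::field mat \<Rightarrow> 'k vec set \<Rightarrow> 'k vec set" where
  "proj_map A P = (\<lambda>x. A *\<^sub>v x) ` P"

definition proj_equivalent :: "nat \<Rightarrow> 'k::field vec set set \<Rightarrow> 'k vec set set \<Rightarrow> bool" where
  "proj_equivalent m Y1 Y2 \<longleftrightarrow>
     (\<exists>A. A \<in> carrier_mat (m + 1) (m + 1) \<and> invertible_mat A \<and> proj_map A ` Y1 = Y2)"

text \<open>
  The points of \<open>\<M>\<^sub>d\<^sup>n\<close>. The parameter \<open>n\<close> is the dimension of the hypersurface,
  so the ambient projective space is \<open>\<P>\<^bsup>n+1\<^esup>\<close>.
\<close>

definition moduli_rel :: "nat \<Rightarrow> nat \<Rightarrow> ('k::field vec set set \<times> 'k vec set set) set" where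
  "moduli_rel n d =
     {(Y1, Y2). Y1 \<in> smooth_hypersurfaces (n + 1) d \<and> Y2 \<in> smooth_hypersurfaces (n + 1) d \<and>
                proj_equivalent (n + 1) Y1 Y2}"

definition moduli :: "nat \<Rightarrow> nat \<Rightarrow> 'k::field vec set set set set" where
  "moduli n d = smooth_hypersurfaces (n + 1) d // moduli_rel n d"

definition moduli_class :: "nat \<Rightarrow> nat \<Rightarrow> 'k::field vec set set \<Rightarrow> 'k vec set set set" where
  "moduli_class n d Y = moduli_rel n d `` {Y}"

definition cyclic_cover :: "nat \<Rightarrow> nat \<Rightarrow> 'k::field mpoly \<Rightarrow> 'k vec set set" where
  "cyclic_cover n d F = zero_locus (n + 2) (mvar (n + 2) ^ d - F)"

text \<open>
  The map \<open>\<Psi>\<^sub>d\<^sup>n\<close>, lifted to classes as a union over all representatives and all their equations.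
  The classes in this union coincide precisely when \<open>[V(F)] \<mapsto> [V(x\<^bsub>n+2\<^esub>\<^sup>d - F)]\<close>
  is well defined.
\<close>

definition Psi :: "nat \<Rightarrow> nat \<Rightarrow> 'k::field vec set set set \<Rightarrow> 'k vec set set set" where
  "Psi n d C =
     (\<Union>F\<in>{F. smooth_form (n + 1) d F \<and> zero_locus (n + 1) F \<in> C}.
        moduli_class (n + 1) d (cyclic_cover n d F))"

end

theory Submission
  imports Defs "Jordan_Normal_Form.Char_Poly"
begin

text \<open>
  A linear equivalence of the two covers is an equality of equations up to a scalar, since a smooth
  form is determined up to a scalar by its zero set: a general deformation of any line not lying
  in the zero set is a line on which the form restricts to a squarefree polynomial, and there the
  zeros determine the restriction.

  Now let \<open>f = x\<^sub>N\<^sup>d - F\<close>. The cover coordinate \<open>l\<close> and the vector \<open>e\<close> along it satisfy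
  \<open>f (x + t e) = f x + (l x + t)\<^sup>d - (l x)\<^sup>d\<close>, and pulling back the corresponding pair for the other
  cover gives a second such pair for \<open>f\<close>. Comparing \<open>f (x + s e\<^sub>1 + t e\<^sub>2)\<close> computed in the two possible
  orders gives \<open>l\<^sub>1 e\<^sub>2 (l\<^sub>1 x)\<^bsup>d-2\<^esup> = l\<^sub>2 e\<^sub>1 (l\<^sub>2 x)\<^bsup>d-2\<^esup>\<close>. Hence either the hyperplanes \<open>l\<^sub>1 = 0\<close> and \<open>l\<^sub>2 = 0\<close> coincide, or
  (after a sign change if \<open>d = 2\<close>) a reflection preserving \<open>f\<close> carries one to the other. Restricting
  to these hyperplanes yields the equivalence of the branch hypersurfaces.
\<close>

text \<open>The obstacle is that an equivalence of covers need not respect the projections: when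
  \<open>F\<close> is \<open>l^d\<close> minus a form in the remaining coordinates, as for Fermat
  forms, the cover has automorphisms carrying the new coordinate to a multiple of \<open>l\<close>.
  So \<open>f\<close> alone does not determine the pair, and two pairs have to be compared. The
  relation between them is the symmetry of second derivatives: the derivative of \<open>f\<close>
  along \<open>e_i\<close> is \<open>d * l_i^(d-1)\<close>, and the mixed derivative along
  \<open>e_1\<close> and \<open>e_2\<close> is \<open>d * (d-1)\<close> times either side.
  Evaluating the relation at \<open>e_1\<close> and \<open>e_2\<close> shows that for
  \<open>d > 2\<close> the constants \<open>l_1 e_2\<close> and \<open>l_2 e_1\<close> vanish
  together, which separates the two outcomes. For the equations themselves, smoothness supplies a
  direction transversal to the zero set at all its points on one line, so that polynomials in one
  and two variables suffice. The scalar between the equations is absorbed by a \<open>d\<close>-th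
  root.\<close>

hide_const (open) module.smult

subsection \<open>Families of univariate polynomials\<close>

text \<open>A nonzero element of least degree in the ideal generated by \<open>a\<close> and
  \<open>b\<close> is their gcd over the fraction field. Pseudo-division keeps the remainders in the
  ideal, at the price of the factors \<open>c1\<close> and \<open>c2\<close>.\<close>

lemma pseudo_gcd:
  fixes a b :: "'r::idom poly"
  assumes "a \<noteq> 0"
  obtains g u w c1 c2 where "g \<noteq> 0" "g = u * a + w * b" "c1 \<noteq> 0" "c2 \<noteq> 0"
    "g dvd smult c1 a" "g dvd smult c2 b"
proof -
  define I where "I = {g. g \<noteq> 0 \<and> (\<exists>u w. g = u * a + w * b)}"
  have "a = 1 * a + 0 * b" "b = 0 * a + 1 * b"
    by auto
  then have "a \<in> I"
    using assms unfolding I_def by blast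
  then obtain g where "g \<in> I" and min: "\<And>f. f \<in> I \<Longrightarrow> degree g \<le> degree f"
    using arg_min_natI[of "\<lambda>f. f \<in> I" a degree] arg_min_nat_le[of "\<lambda>f. f \<in> I" _ degree] by blast
  then obtain u w where g: "g \<noteq> 0" "g = u * a + w * b"
    by (auto simp: I_def)
  have div: "\<exists>c. c \<noteq> 0 \<and> g dvd smult c f" if f: "f = x * a + y * b" for f x y
  proof -
    obtain c q where c: "c \<noteq> 0" "smult c f = g * q + pseudo_mod f g"
      using pseudo_mod(1)[OF g(1), of f] by blast
    then have "pseudo_mod f g = smult c f - g * q"
      by simp
    also have "\<dots> = ([:c:] * x - u * q) * a + ([:c:] * y - w * q) * b"
      unfolding f g(2) by (simp add: algebra_simps smult_add_right)
    finally have eq: "pseudo_mod f g = ([:c:] * x - u * q) * a + ([:c:] * y - w * q) * b" .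
    have "pseudo_mod f g = 0"
    proof (rule ccontr)
      assume nz: "pseudo_mod f g \<noteq> 0"
      with eq have "pseudo_mod f g \<in> I"
        unfolding I_def by blast
      with min pseudo_mod(2)[OF g(1), of f] nz show False
        by fastforce
    qed
    with c show ?thesis
      by auto
  qed
  from div[OF \<open>a = 1 * a + 0 * b\<close>] div[OF \<open>b = 0 * a + 1 * b\<close>] show ?thesis
    using that[OF g] by blast
qed

text \<open>
  Over the fraction field a common factor of \<open>h\<close> and \<open>h'\<close> of least positive degree is coprime to its
  own derivative, and therefore divides \<open>h\<close> twice. Working with multiples \<open>smult c h\<close> avoids the
  fraction field.
\<close>

lemma coprime_pderiv_or_square_factor:
  fixes h :: "'r::{idom, ring_char_0} poly"
  assumes "h \<noteq> 0"
  obtains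
    (coprime) u w c where "c \<noteq> 0" "u * h + w * pderiv h = [:c:]"
  | (square) R q c where "c \<noteq> 0" "degree R > 0" "smult c h = R * R * q"
proof -
  define S where "S = {R. degree R > 0 \<and> (\<exists>c. c \<noteq> 0 \<and> R dvd smult c h \<and> R dvd smult c (pderiv h))}"
  obtain g u w c1 c2 where g: "g \<noteq> 0" "g = u * h + w * pderiv h" "c1 \<noteq> 0" "c2 \<noteq> 0"
    "g dvd smult c1 h" "g dvd smult c2 (pderiv h)"
    using pseudo_gcd[OF assms] by metis
  show ?thesis
  proof (cases "degree g = 0")
    case True
    then obtain c where "g = [:c:]"
      by (elim degree_eq_zeroE)
    with g(1) have "c \<noteq> 0"
      by auto
    with \<open>g = [:c:]\<close> g(2) coprime[of c u w] show ?thesis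
      by metis
  next
    case False
    have "g dvd smult (c2 * c1) h" "g dvd smult (c1 * c2) (pderiv h)"
      using g(5,6) by (metis dvd_smult smult_smult)+
    then have "g \<in> S"
      using False g(3,4) unfolding S_def by (auto simp: mult.commute intro!: exI[of _ "c1 * c2"])
    then obtain R where "R \<in> S" and min: "\<And>f. f \<in> S \<Longrightarrow> degree R \<le> degree f"
      using arg_min_natI[of "\<lambda>f. f \<in> S" g degree] arg_min_nat_le[of "\<lambda>f. f \<in> S" _ degree] by blast
    then obtain c where R: "degree R > 0" "c \<noteq> 0" "R dvd smult c h" "R dvd smult c (pderiv h)"
      unfolding S_def by auto
    from R(1) have "R \<noteq> 0"
      by auto
    then obtain g' u' w' c1' c2' where g': "g' \<noteq> 0" "g' = u' * R + w' * pderiv R" "c1' \<noteq> 0" "c2' \<noteq> 0"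
      "g' dvd smult c1' R" "g' dvd smult c2' (pderiv R)"
      using pseudo_gcd by metis
    have nz: "pderiv R \<noteq> 0"
      using R(1) by (auto simp: pderiv_eq_0_iff)
    \<comment> \<open>The gcd \<open>g'\<close> of \<open>R\<close> and its derivative has smaller
      degree than \<open>R\<close> and still divides multiples of \<open>h\<close> and its
      derivative, so minimality of \<open>R\<close> makes it constant.\<close>
    have "degree g' \<le> degree (smult c2' (pderiv R))"
      using dvd_imp_degree_le[OF g'(6)] nz g'(4) by auto
    also have "\<dots> < degree R"
      using R(1) by (simp add: degree_pderiv g'(4))
    finally have "g' \<notin> S"
      using min by fastforce
    moreover have "g' dvd smult (c1' * c) h" "g' dvd smult (c1' * c) (pderiv h)"
      using dvd_trans[OF g'(5), of "smult c1' (smult c h)"] dvd_trans[OF g'(5), of "smult c1' (smult c (pderiv h))"] R(3,4)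
      by (metis smult_smult smult_dvd_cancel dvd_smult mult_smult_left dvd_def)+
    ultimately have "degree g' = 0"
      using R(2) g'(3) unfolding S_def by auto
    then obtain e where e: "g' = [:e:]"
      by (elim degree_eq_zeroE)
    from R(3) obtain q where q: "smult c h = R * q"
      by (elim dvdE)
    \<comment> \<open>By the product rule \<open>R\<close> divides \<open>pderiv R * q\<close>; the
      identity \<open>[:e:] = u' * R + w' * pderiv R\<close>, multiplied by \<open>q\<close>, then
      removes the factor \<open>pderiv R\<close>.\<close>
    have "smult c (pderiv h) = pderiv R * q + R * pderiv q"
      unfolding pderiv_smult[symmetric] q pderiv_mult by (simp add: algebra_simps)
    with R(4) have "R dvd pderiv R * q"
      by (metis dvd_add_left_iff dvd_triv_left)
    moreover have "smult e q = R * (u' * q) + w' * (pderiv R * q)"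
      using arg_cong[OF g'(2), of "\<lambda>x. x * q"] unfolding e by (simp add: algebra_simps)
    ultimately have "R dvd smult e q"
      by (metis dvd_add dvd_mult dvd_triv_left)
    then obtain r where "smult e q = R * r"
      by (elim dvdE)
    then have "smult (e * c) h = R * R * r"
      using q by (metis mult.assoc mult_smult_right smult_smult)
    moreover have "e * c \<noteq> 0"
      using g'(1) e R(2) by auto
    ultimately show ?thesis
      using square R(1) by blast
  qed
qed

lemma map_poly_comm_ring_hom_eval: "map_poly_comm_ring_hom (\<lambda>p::'a::comm_ring_1 poly. poly p a)"
  by unfold_locales auto

lemma poly_map_poly_eval:
  fixes p :: "'a::comm_ring_1 poly poly"
  shows "poly (map_poly (\<lambda>c. poly c a) p) x = poly (poly p [:x:]) a"
  by (induction p) (auto simp: map_poly_pCons)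

lemma map_poly_eval_0_eq_0:
  fixes p :: "'a::field poly poly"
  assumes "map_poly (\<lambda>c. poly c 0) p = 0"
  obtains p' where "p = smult [:0, 1:] p'"
proof -
  have "[:0, 1:] dvd coeff p i" for i
  proof -
    have "coeff (map_poly (\<lambda>c. poly c 0) p) i = 0"
      using assms by simp
    then have "poly (coeff p i) 0 = 0"
      by (simp add: coeff_map_poly)
    then show ?thesis
      by (simp add: poly_eq_0_iff_dvd)
  qed
  then have "[:[:0, 1:]:] dvd p"
    by (simp add: const_poly_dvd_iff)
  then show ?thesis
    using that by (auto elim: dvdE)
qed

text \<open>If \<open>c\<close> vanished at 0, the identity would specialise to \<open>0 = 0\<close>
  there. As in Gauss's lemma, the prime \<open>[:0, 1:]\<close> dividing \<open>c\<close> must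
  divide \<open>R\<close> or \<open>q\<close>, so it can be cancelled; the degree of
  \<open>c\<close> drops each time.\<close>

lemma square_factor_saturate:
  fixes h :: "'a::field poly poly"
  assumes "smult c h = R * R * q" "c \<noteq> 0"
  shows "\<exists>c' R' q'. poly c' 0 \<noteq> 0 \<and> degree R' = degree R \<and> smult c' h = R' * R' * q'"
  using assms
proof (induction "degree c" arbitrary: c R q rule: less_induct)
  case less
  have X_nz: "[:0, 1:] \<noteq> (0 :: 'a poly)"
    by simp
  interpret ev: map_poly_comm_ring_hom "\<lambda>p::'a poly. poly p 0"
    by (rule map_poly_comm_ring_hom_eval)
  show ?case
  proof (cases "poly c 0 = 0")
    case True
    then obtain e where e: "c = [:0, 1:] * e"
      using poly_eq_0_iff_dvd[of c 0] by (auto elim: dvdE)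
    have "e \<noteq> 0"
      using e less.prems by auto
    then have lt: "degree e < degree c"
      unfolding e by (subst degree_mult_eq) auto
    have "map_poly (\<lambda>c. poly c 0) (R * R * q) = 0"
      unfolding less.prems(1)[symmetric] by (simp add: hom_distribs True)
    then consider "map_poly (\<lambda>c. poly c 0) R = 0" | "map_poly (\<lambda>c. poly c 0) q = 0"
      by (auto simp: hom_distribs)
    then show ?thesis
    proof cases
      case 1
      then obtain R' where R': "R = smult [:0, 1:] R'"
        by (rule map_poly_eval_0_eq_0)
      have "smult [:0, 1:] (smult e h) = smult [:0, 1:] (R' * R' * smult [:0,1:] q)"
        using less.prems(1) unfolding e R' by (simp only: smult_smult mult_smult_left mult_smult_right)
      then have "smult e h = R' * R' * smult [:0,1:] q"
        using X_nz smult_cancel by blast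
      from less.hyps[OF lt this \<open>e \<noteq> 0\<close>] show ?thesis
        unfolding R' by auto
    next
      case 2
      then obtain q' where q': "q = smult [:0, 1:] q'"
        by (rule map_poly_eval_0_eq_0)
      have "smult [:0, 1:] (smult e h) = smult [:0, 1:] (R * R * q')"
        using less.prems(1) unfolding e q' by (simp only: smult_smult mult_smult_left mult_smult_right)
      then have "smult e h = R * R * q'"
        using X_nz smult_cancel by blast
      from less.hyps[OF lt this \<open>e \<noteq> 0\<close>] show ?thesis
        by auto
    qed
  qed (use less.prems in auto)
qed

text \<open>
  \<open>h\<close> is a polynomial in \<open>t\<close> with coefficients in \<open>k[\<epsilon>]\<close>. A square factor of positive degree in \<open>t\<close>
  would give a point on the curve \<open>h = 0\<close> over \<open>\<epsilon> = 0\<close> at which \<open>\<partial>h/\<partial>\<epsilon>\<close> vanishes.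
\<close>

lemma finite_nonsquarefree_specialisations:
  fixes h :: "'a::{alg_closed_field, field_char_0} poly poly"
  assumes lead: "poly (lead_coeff h) 0 \<noteq> 0"
    and smooth: "\<And>\<tau>. poly (poly h [:\<tau>:]) 0 = 0 \<Longrightarrow> poly (pderiv (poly h [:\<tau>:])) 0 \<noteq> 0"
  shows "finite {\<epsilon>. \<not> rsquarefree (map_poly (\<lambda>c. poly c \<epsilon>) h)}"
proof -
  have "h \<noteq> 0"
    using lead by auto
  then show ?thesis
  proof (cases rule: coprime_pderiv_or_square_factor)
    case (coprime u w c)
    \<comment> \<open>The Bezout identity specialises at \<open>\<epsilon>\<close>, so a common zero
      of the specialised \<open>h\<close> and its derivative would force
      \<open>poly c \<epsilon> = 0\<close>.\<close>
    have "rsquarefree (map_poly (\<lambda>c. poly c \<epsilon>) h)" if \<epsilon>: "poly c \<epsilon> \<noteq> 0" for \<epsilon>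
    proof -
      interpret ev: map_poly_comm_ring_hom "\<lambda>p::'a poly. poly p \<epsilon>"
        by (rule map_poly_comm_ring_hom_eval)
      have "map_poly (\<lambda>c. poly c \<epsilon>) (pderiv h) = pderiv (map_poly (\<lambda>c. poly c \<epsilon>) h)"
        by (rule poly_eqI) (simp add: coeff_pderiv)
      then have "map_poly (\<lambda>c. poly c \<epsilon>) u * map_poly (\<lambda>c. poly c \<epsilon>) h
          + map_poly (\<lambda>c. poly c \<epsilon>) w * pderiv (map_poly (\<lambda>c. poly c \<epsilon>) h) = [:poly c \<epsilon>:]"
        using arg_cong[OF coprime(2), of "map_poly (\<lambda>c. poly c \<epsilon>)"]
        by (simp add: hom_distribs)
      then have "poly (map_poly (\<lambda>c. poly c \<epsilon>) u) a * poly (map_poly (\<lambda>c. poly c \<epsilon>) h) a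
          + poly (map_poly (\<lambda>c. poly c \<epsilon>) w) a * poly (pderiv (map_poly (\<lambda>c. poly c \<epsilon>) h)) a
          = poly c \<epsilon>" for a
        by (metis poly_add poly_const_conv poly_mult)
      then show ?thesis
        using \<epsilon> unfolding rsquarefree_roots by (metis add.right_neutral mult_zero_right)
    qed
    then have "{\<epsilon>. \<not> rsquarefree (map_poly (\<lambda>c. poly c \<epsilon>) h)} \<subseteq> {\<epsilon>. poly c \<epsilon> = 0}"
      by auto
    then show ?thesis
      using poly_roots_finite[OF coprime(1)] finite_subset by blast
  next
    case (square R q c)
    interpret ev: map_poly_comm_ring_hom "\<lambda>p::'a poly. poly p 0"
      by (rule map_poly_comm_ring_hom_eval)
    obtain e S r where S: "poly e 0 \<noteq> 0" "degree S = degree R" "smult e h = S * S * r"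
      using square_factor_saturate[OF square(3,1)] by blast
    \<comment> \<open>The leading coefficient of \<open>S\<close> survives at 0, so the specialised
      \<open>S\<close> keeps its positive degree and has a root.\<close>
    have "e * lead_coeff h = lead_coeff S * lead_coeff S * lead_coeff r"
      using arg_cong[OF S(3), of lead_coeff] S(1) by (auto simp: lead_coeff_mult split: if_splits)
    then have "poly (lead_coeff S) 0 \<noteq> 0"
      using S(1) lead by (metis mult_eq_0_iff poly_mult)
    then have "coeff (map_poly (\<lambda>c. poly c 0) S) (degree S) \<noteq> 0"
      by simp
    then have "degree (map_poly (\<lambda>c. poly c 0) S) = degree S"
      using degree_map_poly_le le_degree antisym by blast
    then obtain \<tau> where \<tau>: "poly (map_poly (\<lambda>c. poly c 0) S) \<tau> = 0"
      using alg_closed_imp_poly_has_root S(2) square(2) by metis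
    then have S0: "poly (poly S [:\<tau>:]) 0 = 0"
      by (simp add: poly_map_poly_eval)
    \<comment> \<open>At \<open>t = \<tau>\<close> the right side is a polynomial in
      \<open>\<epsilon>\<close> with a double zero at 0. Since \<open>e\<close> does not vanish
      there, the double zero belongs to \<open>poly h [:\<tau>:]\<close>, against
      \<open>smooth\<close>.\<close>
    have eq: "e * poly h [:\<tau>:] = poly S [:\<tau>:] * poly S [:\<tau>:] * poly r [:\<tau>:]"
      using arg_cong[OF S(3), of "\<lambda>p. poly p [:\<tau>:]"] by simp
    then have h0: "poly (poly h [:\<tau>:]) 0 = 0"
      using S0 S(1) by (metis mult_eq_0_iff poly_mult)
    moreover have "poly e 0 * poly (pderiv (poly h [:\<tau>:])) 0 = 0"
      using S0 h0 arg_cong[OF eq, of "\<lambda>p. poly (pderiv p) 0"] by (simp add: pderiv_mult)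
    ultimately show ?thesis
      using smooth S(1) by auto
  qed
qed

section \<open>Zeros of squarefree polynomials\<close>

lemma card_roots_rsquarefree:
  fixes p :: "'a::alg_closed_field poly"
  assumes "rsquarefree p"
  shows "card {x. poly p x = 0} = degree p"
proof -
  have "p \<noteq> 0"
    using assms by (auto simp: rsquarefree_def)
  then obtain A where A: "size A = degree p" "p = smult (lead_coeff p) (\<Prod>x\<in>#A. [:-x, 1:])"
    using alg_closed_imp_factorization by blast
  have "proots (\<Prod>x\<in>#A. [:-x, 1:]) = A"
  proof (induction A)
    case (add x A)
    have "(\<Prod>y\<in>#A. [:-y, 1:]) \<noteq> 0"
      by (induction A) (simp_all del: mult_pCons_left)
    from proots_mult[OF _ this, of "[:-x, 1:]"] have "proots ([:-x, 1:] * (\<Prod>y\<in>#A. [:-y, 1:])) = {#x#} + A"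
      by (simp only: add) simp
    then show ?case
      by simp
  qed auto
  then have "proots p = A"
    using \<open>p \<noteq> 0\<close> by (metis A(2) leading_coeff_0_iff proots_smult)
  moreover have "proots p = mset_set {x. poly p x = 0}"
  proof (rule multiset_eqI)
    fix x
    have "order x p = 0 \<or> order x p = 1"
      using assms by (auto simp: rsquarefree_def)
    then show "count (proots p) x = count (mset_set {x. poly p x = 0}) x"
      using \<open>p \<noteq> 0\<close> poly_roots_finite[of p] by (auto simp: count_mset_set' order_root)
  qed
  ultimately show ?thesis
    using A(1) by (metis size_mset_set)
qed

text \<open>The difference \<open>g - smult c f\<close> has degree below that of \<open>f\<close>,
  because the top coefficients cancel, and vanishes at as many points as \<open>f\<close> has
  roots.\<close>

lemma eq_smult_if_roots_subset:
  fixes f g :: "'a::alg_closed_field poly"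
  assumes "rsquarefree f" "degree g \<le> degree f"
    and "\<And>x. poly f x = 0 \<Longrightarrow> poly g x = 0"
    and "coeff g (degree f) = c * lead_coeff f"
  shows "g = smult c f"
  by (rule poly_eqI_degree_lead_coeff[where n = "degree f" and A = "{x. poly f x = 0}"])
     (use assms card_roots_rsquarefree[OF assms(1)] in \<open>auto intro: order_trans[OF degree_smult_le]\<close>)

subsection \<open>Substitution into polynomials\<close>

definition monomial_value :: "(nat \<Rightarrow> 'r::comm_ring_1) \<Rightarrow> (nat \<Rightarrow>\<^sub>0 nat) \<Rightarrow> 'r" where
  "monomial_value w a = (\<Prod>i\<in>Poly_Mapping.keys a. w i ^ Poly_Mapping.lookup a i)"

text \<open>The coefficient map \<open>\<phi>\<close> lets one definition serve for values in
  \<open>k\<close>, in \<open>k[t]\<close> (lines) and in \<open>k[\<epsilon>][t]\<close> (families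
  of lines); \<open>hom_msubst\<close> passes between them by specialisation.\<close>

definition msubst :: "('k::comm_ring_1 \<Rightarrow> 'r::comm_ring_1) \<Rightarrow> 'k mpoly \<Rightarrow> (nat \<Rightarrow> 'r) \<Rightarrow> 'r" where
  "msubst \<phi> F w = (\<Sum>a\<in>Poly_Mapping.keys F. \<phi> (Poly_Mapping.lookup F a) * monomial_value w a)"

lemma meval_eq_msubst: "meval F x = msubst (\<lambda>c. c) F (\<lambda>i. x $ i)"
  by (simp add: meval_def msubst_def monomial_value_def)

lemma monomial_value_superset:
  assumes "finite S" "Poly_Mapping.keys a \<subseteq> S"
  shows "monomial_value w a = (\<Prod>i\<in>S. w i ^ Poly_Mapping.lookup a i)"
  unfolding monomial_value_def
  by (rule prod.mono_neutral_left) (use assms in \<open>auto simp: in_keys_iff\<close>)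

lemma msubst_superset:
  assumes "finite S" "Poly_Mapping.keys F \<subseteq> S" "\<phi> 0 = 0"
  shows "msubst \<phi> F w = (\<Sum>a\<in>S. \<phi> (Poly_Mapping.lookup F a) * monomial_value w a)"
  unfolding msubst_def
  by (rule sum.mono_neutral_left) (use assms in \<open>auto simp: in_keys_iff\<close>)

lemma msubst_zero [simp]: "msubst \<phi> 0 w = 0"
  by (simp add: msubst_def)

lemma msubst_single:
  assumes "\<phi> 0 = 0"
  shows "msubst \<phi> (Poly_Mapping.single a c) w = \<phi> c * monomial_value w a"
  by (subst msubst_superset[of "{a}"]) (use assms in auto)

lemma msubst_add:
  assumes "comm_ring_hom \<phi>"
  shows "msubst \<phi> (F + G) w = msubst \<phi> F w + msubst \<phi> G w"
proof -
  interpret comm_ring_hom \<phi> by fact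
  let ?S = "Poly_Mapping.keys F \<union> Poly_Mapping.keys G"
  have "msubst \<phi> (F + G) w = (\<Sum>a\<in>?S. \<phi> (Poly_Mapping.lookup (F + G) a) * monomial_value w a)"
    using Poly_Mapping.keys_add[of F G] by (intro msubst_superset) auto
  moreover have "msubst \<phi> F w = (\<Sum>a\<in>?S. \<phi> (Poly_Mapping.lookup F a) * monomial_value w a)"
    by (intro msubst_superset) auto
  moreover have "msubst \<phi> G w = (\<Sum>a\<in>?S. \<phi> (Poly_Mapping.lookup G a) * monomial_value w a)"
    by (intro msubst_superset) auto
  ultimately show ?thesis
    by (simp add: lookup_add hom_distribs sum.distrib distrib_right)
qed

lemma msubst_diff:
  assumes "comm_ring_hom \<phi>"
  shows "msubst \<phi> (F - G) w = msubst \<phi> F w - msubst \<phi> G w"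
  using msubst_add[OF assms, of "F - G" G w] by simp

lemma msubst_sum:
  assumes "comm_ring_hom \<phi>"
  shows "msubst \<phi> (sum F S) w = (\<Sum>s\<in>S. msubst \<phi> (F s) w)"
  by (induction S rule: infinite_finite_induct) (auto simp: msubst_add[OF assms])

lemma mvar_power: "mvar i ^ d = Poly_Mapping.single (Poly_Mapping.single i d) 1"
  by (induction d) (auto simp: mvar_def mult_single Poly_Mapping.single_add[symmetric])

lemma msubst_mvar_power:
  assumes "comm_ring_hom \<phi>"
  shows "msubst \<phi> (mvar i ^ d) w = w i ^ d"
proof -
  interpret comm_ring_hom \<phi> by fact
  show ?thesis
    unfolding mvar_power by (subst msubst_single) (auto simp: monomial_value_def)
qed

lemma hom_msubst:
  assumes "comm_ring_hom \<psi>"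
  shows "\<psi> (msubst \<phi> F w) = msubst (\<lambda>c. \<psi> (\<phi> c)) F (\<lambda>i. \<psi> (w i))"
proof -
  interpret comm_ring_hom \<psi> by fact
  show ?thesis
    by (simp add: msubst_def monomial_value_def hom_distribs)
qed

lemma msubst_cong:
  assumes "homogeneous m d F" "\<And>i. i \<le> m \<Longrightarrow> w i = w' i"
  shows "msubst \<phi> F w = msubst \<phi> F w'"
  unfolding msubst_def monomial_value_def
proof (intro sum.cong refl arg_cong2[where f = "(*)"] prod.cong arg_cong2[where f = "(^)"])
  fix a i assume "a \<in> Poly_Mapping.keys F" "i \<in> Poly_Mapping.keys a"
  then have "i \<le> m"
    using assms(1) by (fastforce simp: homogeneous_def)
  then show "w i = w' i"
    by (rule assms)
qed

lemma monomial_value_scale: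
  "monomial_value (\<lambda>i. c * w i) a = c ^ (\<Sum>i\<in>Poly_Mapping.keys a. Poly_Mapping.lookup a i) * monomial_value w a"
  by (simp add: monomial_value_def power_mult_distrib prod.distrib power_sum)

lemma msubst_scale:
  assumes "homogeneous m d F"
  shows "msubst \<phi> F (\<lambda>i. c * w i) = c ^ d * msubst \<phi> F w"
  unfolding msubst_def sum_distrib_left
  by (rule sum.cong) (use assms in \<open>auto simp: homogeneous_def monomial_value_scale mult_ac\<close>)

text \<open>Here \<open>m\<close> and \<open>n\<close> are formal degrees: the coefficients there
  may be zero or multiply to zero, as happens for directions with vanishing coordinates.\<close>

lemma degree_coeff_mult_bound:
  fixes p q :: "'a::comm_ring_1 poly"
  assumes "degree p \<le> m" "degree q \<le> n"
  shows "degree (p * q) \<le> m + n" "coeff (p * q) (m + n) = coeff p m * coeff q n"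
proof -
  show "degree (p * q) \<le> m + n"
    using degree_mult_le[of p q] assms by linarith
  have "coeff (p * q) (m + n) = (\<Sum>i\<le>m + n. coeff p i * coeff q (m + n - i))"
    by (rule coeff_mult)
  also have "\<dots> = (\<Sum>i\<in>{m}. coeff p i * coeff q (m + n - i))"
  proof (intro sum.mono_neutral_right ballI)
    fix i assume "i \<in> {..m + n} - {m}"
    then consider "i > m" | "m + n - i > n"
      by force
    then show "coeff p i * coeff q (m + n - i) = 0"
      using assms by cases (auto simp: coeff_eq_0)
  qed auto
  finally show "coeff (p * q) (m + n) = coeff p m * coeff q n"
    by simp
qed

lemma degree_coeff_linear_power:
  fixes a b :: "'a::comm_ring_1"
  shows "degree ([:a, b:] ^ n) \<le> n \<and> coeff ([:a, b:] ^ n) n = b ^ n"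
proof (induction n)
  case (Suc n)
  have "degree [:a, b:] \<le> 1"
    by simp
  from degree_coeff_mult_bound[OF this, of "[:a, b:] ^ n" n] Suc show ?case
    by (auto simp del: mult_pCons_left)
qed simp

lemma degree_coeff_monomial_value_linear:
  "degree (monomial_value (\<lambda>i. [:x i, v i:]) a) \<le> (\<Sum>i\<in>Poly_Mapping.keys a. Poly_Mapping.lookup a i) \<and>
   coeff (monomial_value (\<lambda>i. [:x i, v i:]) a) (\<Sum>i\<in>Poly_Mapping.keys a. Poly_Mapping.lookup a i)
     = monomial_value v a"
proof -
  have "degree (\<Prod>i\<in>S. [:x i, v i:] ^ e i) \<le> sum e S \<and>
      coeff (\<Prod>i\<in>S. [:x i, v i:] ^ e i) (sum e S) = (\<Prod>i\<in>S. v i ^ e i)" if "finite S" for S and e :: "nat \<Rightarrow> nat"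
    using that
  proof (induction S)
    case (insert i S)
    show ?case
      using insert degree_coeff_mult_bound[OF conjunct1[OF degree_coeff_linear_power[of "x i" "v i" "e i"]], of "\<Prod>i\<in>S. [:x i, v i:] ^ e i" "sum e S"]
        degree_coeff_linear_power[of "x i" "v i" "e i"]
      by auto
  qed auto
  then show ?thesis
    by (simp add: monomial_value_def)
qed

text \<open>All monomials have degree \<open>d\<close>, so \<open>t^d\<close> arises only by taking
  the \<open>t\<close>-term of every factor: the base point \<open>x\<close> drops out.\<close>

lemma degree_coeff_msubst_linear:
  assumes "homogeneous m d F"
  shows "degree (msubst (\<lambda>c. [:f c:]) F (\<lambda>i. [:x i, v i:])) \<le> d"
    and "coeff (msubst (\<lambda>c. [:f c:]) F (\<lambda>i. [:x i, v i:])) d = msubst f F v"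
proof -
  have *: "degree (monomial_value (\<lambda>i. [:x i, v i:]) a) \<le> d \<and>
      coeff (monomial_value (\<lambda>i. [:x i, v i:]) a) d = monomial_value v a"
    if "a \<in> Poly_Mapping.keys F" for a
    using degree_coeff_monomial_value_linear[of x v a] assms that by (simp add: homogeneous_def)
  show "degree (msubst (\<lambda>c. [:f c:]) F (\<lambda>i. [:x i, v i:])) \<le> d"
    unfolding msubst_def
    by (intro degree_sum_le) (use * in \<open>auto intro: order_trans[OF degree_smult_le]\<close>)
  show "coeff (msubst (\<lambda>c. [:f c:]) F (\<lambda>i. [:x i, v i:])) d = msubst f F v"
    unfolding msubst_def coeff_sum by (intro sum.cong) (use * in auto)
qed

lemma monomial_value_pderiv:
  fixes x v :: "nat \<Rightarrow> 'a::idom"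
  shows "poly (pderiv (monomial_value (\<lambda>i. [:x i, v i:]) a)) 0 =
    (\<Sum>i\<in>Poly_Mapping.keys a. v i * of_nat (Poly_Mapping.lookup a i) * monomial_value x (a - Poly_Mapping.single i 1))"
  unfolding monomial_value_def[of "\<lambda>i. [:x i, v i:]"] pderiv_prod poly_sum
proof (rule sum.cong[OF refl])
  fix i assume i: "i \<in> Poly_Mapping.keys a"
  let ?K = "Poly_Mapping.keys a"
  have look: "Poly_Mapping.lookup (a - Poly_Mapping.single i 1) j =
      (if j = i then Poly_Mapping.lookup a i - 1 else Poly_Mapping.lookup a j)" for j
    by (auto simp: lookup_minus lookup_single)
  have "Poly_Mapping.keys (a - Poly_Mapping.single i 1) \<subseteq> ?K"
    by (auto simp: in_keys_iff look simp del: One_nat_def split: if_splits)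
  then have "monomial_value x (a - Poly_Mapping.single i 1)
      = (\<Prod>j\<in>?K. x j ^ Poly_Mapping.lookup (a - Poly_Mapping.single i 1) j)"
    by (intro monomial_value_superset) auto
  also have "\<dots> = x i ^ (Poly_Mapping.lookup a i - 1) *
      (\<Prod>j\<in>?K - {i}. x j ^ Poly_Mapping.lookup (a - Poly_Mapping.single i 1) j)"
    using i by (subst prod.remove[of _ i]) (simp_all add: look del: One_nat_def)
  also have "(\<Prod>j\<in>?K - {i}. x j ^ Poly_Mapping.lookup (a - Poly_Mapping.single i 1) j)
      = (\<Prod>j\<in>?K - {i}. x j ^ Poly_Mapping.lookup a j)"
    by (rule prod.cong) (simp_all add: look del: One_nat_def)
  finally have "monomial_value x (a - Poly_Mapping.single i 1) = x i ^ (Poly_Mapping.lookup a i - 1) *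
      (\<Prod>j\<in>?K - {i}. x j ^ Poly_Mapping.lookup a j)" .
  then show "poly ((\<Prod>i\<in>?K - {i}. [:x i, v i:] ^ Poly_Mapping.lookup a i) *
      pderiv ([:x i, v i:] ^ Poly_Mapping.lookup a i)) 0 =
      v i * of_nat (Poly_Mapping.lookup a i) * monomial_value x (a - Poly_Mapping.single i 1)"
    by (simp add: poly_prod pderiv_power pderiv_pCons mult_ac)
qed

lemma comm_ring_hom_id: "comm_ring_hom (\<lambda>c. c)"
  by unfold_locales auto

lemma msubst_mderiv:
  "msubst (\<lambda>c. c) (mderiv i F) x =
    (\<Sum>a\<in>Poly_Mapping.keys F. of_nat (Poly_Mapping.lookup a i) * Poly_Mapping.lookup F a *
       monomial_value x (a - Poly_Mapping.single i 1))"
  unfolding mderiv_def msubst_sum[OF comm_ring_hom_id] by (simp add: msubst_single)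

text \<open>The chain rule at \<open>t = 0\<close>. It turns the Jacobian criterion into a statement
  about restrictions to lines.\<close>

lemma pderiv_msubst_line:
  fixes x v :: "nat \<Rightarrow> 'a::field"
  assumes "homogeneous m d F"
  shows "poly (pderiv (msubst (\<lambda>c. [:c:]) F (\<lambda>i. [:x i, v i:]))) 0 =
    (\<Sum>i\<le>m. v i * msubst (\<lambda>c. c) (mderiv i F) x)"
proof -
  have "poly (pderiv (msubst (\<lambda>c. [:c:]) F (\<lambda>i. [:x i, v i:]))) 0 =
     (\<Sum>a\<in>Poly_Mapping.keys F. Poly_Mapping.lookup F a *
       (\<Sum>i\<in>Poly_Mapping.keys a. v i * of_nat (Poly_Mapping.lookup a i) * monomial_value x (a - Poly_Mapping.single i 1)))"
    unfolding msubst_def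
    by (simp add: pderiv_sum pderiv_smult poly_sum monomial_value_pderiv)
  also have "\<dots> = (\<Sum>a\<in>Poly_Mapping.keys F. Poly_Mapping.lookup F a *
       (\<Sum>i\<le>m. v i * of_nat (Poly_Mapping.lookup a i) * monomial_value x (a - Poly_Mapping.single i 1)))"
  proof (rule sum.cong[OF refl], rule arg_cong2[where f = "(*)", OF refl], rule sum.mono_neutral_left)
    fix a assume "a \<in> Poly_Mapping.keys F"
    then show "Poly_Mapping.keys a \<subseteq> {..m}"
      using assms by (fastforce simp: homogeneous_def)
  qed (auto simp: in_keys_iff)
  also have "\<dots> = (\<Sum>i\<le>m. v i * msubst (\<lambda>c. c) (mderiv i F) x)"
    unfolding msubst_mderiv sum_distrib_left by (subst sum.swap) (simp add: mult_ac)
  finally show ?thesis .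
qed

subsection \<open>Smooth forms are determined by their zero sets\<close>

lemma comm_ring_hom_const: "comm_ring_hom (\<lambda>c::'a::comm_ring_1. [:c:])"
  by unfold_locales (auto simp: one_pCons)

lemma comm_ring_hom_poly: "comm_ring_hom (\<lambda>p::'a::comm_ring_1 poly. poly p a)"
  by unfold_locales auto

lemma comm_ring_hom_map_poly:
  "comm_ring_hom (map_poly (\<lambda>p::'a::comm_ring_1 poly. poly p a))"
proof -
  interpret map_poly_comm_ring_hom "\<lambda>p::'a poly. poly p a"
    by (rule map_poly_comm_ring_hom_eval)
  show ?thesis
    by unfold_locales
qed

definition line_restriction :: "'k::comm_ring_1 mpoly \<Rightarrow> 'k vec \<Rightarrow> 'k vec \<Rightarrow> 'k poly" where
  "line_restriction F x v = msubst (\<lambda>c. [:c:]) F (\<lambda>i. [:x $ i, v $ i:])"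

lemma meval_cong:
  assumes "homogeneous m d F" "\<And>i. i \<le> m \<Longrightarrow> x $ i = y $ i"
  shows "meval F x = meval F y"
  unfolding meval_eq_msubst by (rule msubst_cong) (use assms in auto)

lemma meval_smult:
  assumes "homogeneous m d F" "x \<in> carrier_vec (m + 1)"
  shows "meval F (c \<cdot>\<^sub>v x) = c ^ d * meval F x"
proof -
  have "meval F (c \<cdot>\<^sub>v x) = msubst (\<lambda>c. c) F (\<lambda>i. c * x $ i)"
    unfolding meval_eq_msubst by (rule msubst_cong[OF assms(1)]) (use assms(2) in auto)
  then show ?thesis
    by (simp add: msubst_scale[OF assms(1)] meval_eq_msubst)
qed

lemma poly_line_restriction:
  assumes "homogeneous m d F" "x \<in> carrier_vec (m + 1)" "v \<in> carrier_vec (m + 1)"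
  shows "poly (line_restriction F x v) t = meval F (x + t \<cdot>\<^sub>v v)"
proof -
  have "poly (line_restriction F x v) t = msubst (\<lambda>c. c) F (\<lambda>i. x $ i + t * v $ i)"
    unfolding line_restriction_def by (subst hom_msubst[OF comm_ring_hom_poly]) simp
  also have "\<dots> = meval F (x + t \<cdot>\<^sub>v v)"
    unfolding meval_eq_msubst by (rule msubst_cong[OF assms(1)]) (use assms in auto)
  finally show ?thesis .
qed

lemma degree_line_restriction:
  assumes "homogeneous m d F"
  shows "degree (line_restriction F x v) \<le> d" "coeff (line_restriction F x v) d = meval F v"
  using degree_coeff_msubst_linear[OF assms, of "\<lambda>c. c"]
  by (auto simp: line_restriction_def meval_eq_msubst)

lemma pderiv_line_restriction:
  fixes F :: "'k::field mpoly"
  assumes "homogeneous m d F"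
  shows "poly (pderiv (line_restriction F x v)) 0 = (\<Sum>i\<le>m. v $ i * meval (mderiv i F) x)"
  unfolding line_restriction_def pderiv_msubst_line[OF assms] by (simp add: meval_eq_msubst)

section \<open>Points, zero loci and smoothness on representing vectors\<close>

definition point :: "nat \<Rightarrow> 'k::field vec \<Rightarrow> 'k vec set" where
  "point m x = scaling_rel m `` {x}"

lemma smult_vec_eq_0_iff:
  fixes x :: "'k::field vec"
  assumes "x \<in> carrier_vec n"
  shows "c \<cdot>\<^sub>v x = 0\<^sub>v n \<longleftrightarrow> c = 0 \<or> x = 0\<^sub>v n"
  using assms by (auto simp: vec_eq_iff)

lemma mem_point_iff:
  assumes "x \<in> carrier_vec (m + 1)" "x \<noteq> 0\<^sub>v (m + 1)"
  shows "y \<in> point m x \<longleftrightarrow> (\<exists>c. c \<noteq> 0 \<and> y = c \<cdot>\<^sub>v x)"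
  using assms by (auto simp: point_def scaling_rel_def smult_vec_eq_0_iff)

lemma self_mem_point:
  assumes "x \<in> carrier_vec (m + 1)" "x \<noteq> 0\<^sub>v (m + 1)"
  shows "x \<in> point m x"
  unfolding mem_point_iff[OF assms] by (rule exI[of _ 1]) simp

text \<open>Homogeneity makes vanishing independent of the representative, so vectors can stand for
  points in the arguments that follow.\<close>

lemma zero_locus_eq:
  assumes "homogeneous m d F"
  shows "zero_locus m F = point m ` {x \<in> carrier_vec (m + 1). x \<noteq> 0\<^sub>v (m + 1) \<and> meval F x = 0}"
proof -
  have "proj_space m = point m ` (carrier_vec (m + 1) - {0\<^sub>v (m + 1)} :: 'a vec set)"
    by (auto simp: proj_space_def quotient_def point_def)
  moreover have "(\<forall>y\<in>point m x. meval F y = 0) \<longleftrightarrow> meval F x = 0"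
    if x: "x \<in> carrier_vec (m + 1)" "x \<noteq> 0\<^sub>v (m + 1)" for x
  proof
    assume "\<forall>y\<in>point m x. meval F y = 0"
    then show "meval F x = 0"
      using self_mem_point[OF x] by blast
  next
    assume "meval F x = 0"
    then show "\<forall>y\<in>point m x. meval F y = 0"
      by (auto simp: mem_point_iff[OF x] meval_smult[OF assms x(1)])
  qed
  ultimately show ?thesis
    by (auto simp: zero_locus_def)
qed

lemma point_mem_zero_locus_iff:
  assumes "homogeneous m d F" "x \<in> carrier_vec (m + 1)" "x \<noteq> 0\<^sub>v (m + 1)"
  shows "point m x \<in> zero_locus m F \<longleftrightarrow> meval F x = 0"
proof
  assume "point m x \<in> zero_locus m F"
  then show "meval F x = 0"
    using self_mem_point[OF assms(2,3)] by (auto simp: zero_locus_def)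
next
  assume "meval F x = 0"
  then show "point m x \<in> zero_locus m F"
    using assms by (auto simp: zero_locus_eq[OF assms(1)])
qed

lemma smooth_formD:
  assumes "smooth_form m d F" "x \<in> carrier_vec (m + 1)" "x \<noteq> 0\<^sub>v (m + 1)" "meval F x = 0"
  obtains i where "i \<le> m" "meval (mderiv i F) x \<noteq> 0"
  using assms point_mem_zero_locus_iff[of m d F x] self_mem_point[of x m]
  unfolding smooth_form_def by blast

lemma smooth_formI:
  assumes hom: "homogeneous m d F" and "F \<noteq> 0"
    and "\<And>x. x \<in> carrier_vec (m + 1) \<Longrightarrow> x \<noteq> 0\<^sub>v (m + 1) \<Longrightarrow> meval F x = 0 \<Longrightarrow> \<exists>i\<le>m. meval (mderiv i F) x \<noteq> 0"
  shows "smooth_form m d F"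
proof -
  have "\<exists>i\<le>m. meval (mderiv i F) y \<noteq> 0" if "P \<in> zero_locus m F" "y \<in> P" for P y
  proof -
    from that obtain x where x: "x \<in> carrier_vec (m + 1)" "x \<noteq> 0\<^sub>v (m + 1)" "P = point m x"
      unfolding zero_locus_eq[OF hom] by auto
    with that obtain c where "c \<noteq> 0" "y = c \<cdot>\<^sub>v x"
      using mem_point_iff[OF x(1,2)] by auto
    with x have "y \<in> carrier_vec (m + 1)" "y \<noteq> 0\<^sub>v (m + 1)"
      by (auto simp: smult_vec_eq_0_iff)
    moreover have "meval F y = 0"
      using that by (auto simp: zero_locus_def)
    ultimately show ?thesis
      using assms(3) by blast
  qed
  then show ?thesis
    using assms(1,2) by (auto simp: smooth_form_def)
qed

text \<open>A form vanishing at every vector would restrict to 0 on every line, so all its partial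
  derivatives would vanish at \<open>?x\<close>, contradicting smoothness there.\<close>

lemma smooth_form_nonvanishing:
  fixes F :: "'k::field_char_0 mpoly"
  assumes "smooth_form m d F"
  obtains p where "p \<in> carrier_vec (m + 1)" "meval F p \<noteq> 0"
proof (rule ccontr)
  assume "\<not> thesis"
  then have zero: "meval F x = 0" if "x \<in> carrier_vec (m + 1)" for x
    using that \<open>\<And>p. p \<in> carrier_vec (m + 1) \<Longrightarrow> meval F p \<noteq> 0 \<Longrightarrow> thesis\<close> by blast
  have hom: "homogeneous m d F"
    using assms by (simp add: smooth_form_def)
  let ?x = "unit_vec (m + 1) 0 :: 'k vec"
  have x: "?x \<in> carrier_vec (m + 1)" "?x \<noteq> 0\<^sub>v (m + 1)"
    by (auto simp: vec_eq_iff)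
  obtain i where i: "i \<le> m" "meval (mderiv i F) ?x \<noteq> 0"
    using smooth_formD[OF assms x zero[OF x(1)]] .
  have v: "unit_vec (m + 1) i \<in> carrier_vec (m + 1)"
    by simp
  have "poly (line_restriction F ?x (unit_vec (m + 1) i)) = poly 0"
    unfolding fun_eq_iff poly_line_restriction[OF hom x(1) v] by (auto intro!: zero)
  then have "line_restriction F ?x (unit_vec (m + 1) i) = 0"
    by (simp only: poly_eq_poly_eq_iff)
  then have "0 = (\<Sum>j\<le>m. unit_vec (m + 1) i $ j * meval (mderiv j F) ?x)"
    using pderiv_line_restriction[OF hom, of ?x "unit_vec (m + 1) i"] by simp
  also have "\<dots> = (\<Sum>j\<in>{i}. unit_vec (m + 1) i $ j * meval (mderiv j F) ?x)"
    using i(1) by (intro sum.mono_neutral_right) auto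
  finally show False
    using i by simp
qed

text \<open>The vector is taken on the moment curve \<open>(1, s, ..., s^m)\<close>. Each condition
  excludes only the roots of the nonzero polynomial \<open>P t\<close>, and the field is
  infinite.\<close>

lemma common_nonvanishing_vector:
  fixes g :: "'t \<Rightarrow> nat \<Rightarrow> 'k::field_char_0"
  assumes "finite T" "\<And>t. t \<in> T \<Longrightarrow> \<exists>i\<le>m. g t i \<noteq> 0"
  obtains v where "\<And>t. t \<in> T \<Longrightarrow> (\<Sum>i\<le>m. v i * g t i) \<noteq> 0"
proof -
  define P where "P t = (\<Sum>i\<le>m. monom (g t i) i)" for t
  have "coeff (P t) i = g t i" if "i \<le> m" for t i
    using that by (simp add: P_def coeff_sum)
  then have "P t \<noteq> 0" if "t \<in> T" for t
    using assms(2)[OF that] by (metis coeff_0)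
  then have "(\<Prod>t\<in>T. P t) \<noteq> 0"
    using assms(1) by simp
  then have "finite {s. poly (\<Prod>t\<in>T. P t) s = 0}"
    by (rule poly_roots_finite)
  then obtain s where "poly (\<Prod>t\<in>T. P t) s \<noteq> 0"
    using infinite_UNIV_char_0 by (metis (mono_tags, lifting) UNIV_eq_I mem_Collect_eq)
  then have "poly (P t) s \<noteq> 0" if "t \<in> T" for t
    using that assms(1) by (simp add: poly_prod)
  then show ?thesis
    by (intro that[of "\<lambda>i. s ^ i"]) (simp add: P_def poly_sum poly_monom mult.commute)
qed

text \<open>The line through \<open>q\<close> in direction \<open>p\<close> meets the zero set in
  finitely many points because \<open>F p\<close> is nonzero. The direction \<open>v\<close> is
  transversal to the zero set at all of them; \<open>nz\<close> keeps the line away from the origin,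
  where the Jacobian criterion says nothing.\<close>

lemma generic_line_squarefree:
  fixes F :: "'k::{alg_closed_field, field_char_0} mpoly"
  assumes smooth: "smooth_form m d F" and p: "p \<in> carrier_vec (m + 1)" "meval F p \<noteq> 0"
    and q: "q \<in> carrier_vec (m + 1)" and nz: "\<And>\<tau>. q + \<tau> \<cdot>\<^sub>v p \<noteq> 0\<^sub>v (m + 1)"
  obtains v where "v \<in> carrier_vec (m + 1)"
    "finite {\<epsilon>. \<not> rsquarefree (line_restriction F (q + \<epsilon> \<cdot>\<^sub>v v) p)}"
proof -
  have hom: "homogeneous m d F"
    using smooth by (simp add: smooth_form_def)
  define T where "T = {\<tau>. meval F (q + \<tau> \<cdot>\<^sub>v p) = 0}"
  have "line_restriction F q p \<noteq> 0"
    using degree_line_restriction(2)[OF hom, of q p] p(2) by auto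
  then have "finite T"
    using poly_roots_finite by (simp add: T_def poly_line_restriction[OF hom q p(1), symmetric])
  moreover have "\<exists>i\<le>m. meval (mderiv i F) (q + \<tau> \<cdot>\<^sub>v p) \<noteq> 0" if "\<tau> \<in> T" for \<tau>
  proof -
    have "q + \<tau> \<cdot>\<^sub>v p \<in> carrier_vec (m + 1)"
      using p q by simp
    from smooth_formD[OF smooth this nz] that show ?thesis
      unfolding T_def by blast
  qed
  ultimately obtain w where w: "\<And>\<tau>. \<tau> \<in> T \<Longrightarrow> (\<Sum>i\<le>m. w i * meval (mderiv i F) (q + \<tau> \<cdot>\<^sub>v p)) \<noteq> 0"
    using common_nonvanishing_vector[of T m "\<lambda>\<tau> i. meval (mderiv i F) (q + \<tau> \<cdot>\<^sub>v p)"] by blast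
  define v where "v = vec (m + 1) w"
  have v: "v \<in> carrier_vec (m + 1)"
    by (simp add: v_def)
  \<comment> \<open>The two-parameter family \<open>(q + \<epsilon> v) + t p\<close>, with
    \<open>\<epsilon>\<close> in the coefficients and \<open>t\<close> as the outer variable. Fixing
    \<open>t\<close> gives lines in direction \<open>v\<close>, fixing \<open>\<epsilon>\<close>
    gives lines in direction \<open>p\<close>.\<close>
  define h where "h = msubst (\<lambda>c. [:[:c:]:]) F (\<lambda>i. [:[:q $ i, v $ i:], [:p $ i:]:])"
  have "degree h \<le> d" and "coeff h d = msubst (\<lambda>c. [:c:]) F (\<lambda>i. [:p $ i:])"
    unfolding h_def by (rule degree_coeff_msubst_linear[OF hom])+
  moreover have "msubst (\<lambda>c. [:c:]) F (\<lambda>i. [:p $ i:]) = [:meval F p:]"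
    unfolding meval_eq_msubst by (subst hom_msubst[OF comm_ring_hom_const]) simp
  \<comment> \<open>The leading coefficient is constant in \<open>\<epsilon>\<close>, so the degree
    in \<open>t\<close> never drops.\<close>
  ultimately have lead: "lead_coeff h = [:meval F p:]"
    using p(2) by (metis antisym le_degree pCons_eq_0_iff)
  have h_\<tau>: "poly h [:\<tau>:] = line_restriction F (q + \<tau> \<cdot>\<^sub>v p) v" for \<tau>
  proof -
    have "poly h [:\<tau>:] = msubst (\<lambda>c. [:c:]) F (\<lambda>i. [:q $ i + \<tau> * p $ i, v $ i:])"
      unfolding h_def by (subst hom_msubst[OF comm_ring_hom_poly]) (simp add: mult.commute)
    also have "\<dots> = line_restriction F (q + \<tau> \<cdot>\<^sub>v p) v"
      unfolding line_restriction_def by (rule msubst_cong[OF hom]) (use p q in auto)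
    finally show ?thesis .
  qed
  have h_\<epsilon>: "map_poly (\<lambda>c. poly c \<epsilon>) h = line_restriction F (q + \<epsilon> \<cdot>\<^sub>v v) p" for \<epsilon>
  proof -
    have "map_poly (\<lambda>c. poly c \<epsilon>) h = msubst (\<lambda>c. [:c:]) F (\<lambda>i. [:q $ i + \<epsilon> * v $ i, p $ i:])"
      unfolding h_def hom_msubst[OF comm_ring_hom_map_poly]
      by (intro arg_cong3[where f = msubst] ext poly_eqI) (auto simp: coeff_map_poly coeff_pCons split: nat.splits)
    also have "\<dots> = line_restriction F (q + \<epsilon> \<cdot>\<^sub>v v) p"
      unfolding line_restriction_def by (rule msubst_cong[OF hom]) (use v q in auto)
    finally show ?thesis .
  qed
  have "finite {\<epsilon>. \<not> rsquarefree (map_poly (\<lambda>c. poly c \<epsilon>) h)}"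
  proof (rule finite_nonsquarefree_specialisations)
    show "poly (lead_coeff h) 0 \<noteq> 0"
      using p(2) by (simp add: lead)
  next
    fix \<tau> assume "poly (poly h [:\<tau>:]) 0 = 0"
    moreover have "q + \<tau> \<cdot>\<^sub>v p + 0 \<cdot>\<^sub>v v = q + \<tau> \<cdot>\<^sub>v p"
      using p q v by auto
    ultimately have "\<tau> \<in> T"
      using p q v by (simp add: h_\<tau> T_def poly_line_restriction[OF hom])
    from w[OF this] show "poly (pderiv (poly h [:\<tau>:])) 0 \<noteq> 0"
      by (simp add: h_\<tau> pderiv_line_restriction[OF hom] v_def)
  qed
  then show ?thesis
    by (intro that[OF v]) (simp add: h_\<epsilon>)
qed

text \<open>All comparison lines have direction \<open>p\<close>, so their top coefficients are
  always \<open>meval F p\<close> and \<open>meval G (A *\<^sub>v p)\<close>. This is why a single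
  \<open>c\<close> works for every line.\<close>

lemma form_proportional_if_vanishes_on_smooth:
  fixes F G :: "'k::{alg_closed_field, field_char_0} mpoly"
  assumes smooth: "smooth_form m d F" and homG: "homogeneous m d G"
    and A: "A \<in> carrier_mat (m + 1) (m + 1)"
    and van: "\<And>x. x \<in> carrier_vec (m + 1) \<Longrightarrow> meval F x = 0 \<Longrightarrow> meval G (A *\<^sub>v x) = 0"
  obtains c where "\<And>x. x \<in> carrier_vec (m + 1) \<Longrightarrow> meval G (A *\<^sub>v x) = c * meval F x"
proof -
  have hom: "homogeneous m d F"
    using smooth by (simp add: smooth_form_def)
  obtain p where p: "p \<in> carrier_vec (m + 1)" "meval F p \<noteq> 0"
    using smooth_form_nonvanishing[OF smooth] .
  define c where "c = meval G (A *\<^sub>v p) / meval F p"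
  have Ac: "A *\<^sub>v x \<in> carrier_vec (m + 1)" if "x \<in> carrier_vec (m + 1)" for x
    using A that by simp
  have A_line: "A *\<^sub>v (x + t \<cdot>\<^sub>v y) = A *\<^sub>v x + t \<cdot>\<^sub>v (A *\<^sub>v y)"
    if "x \<in> carrier_vec (m + 1)" "y \<in> carrier_vec (m + 1)" for x y t
    using A that by (simp add: mult_add_distrib_mat_vec mult_mat_vec)
  have "meval G (A *\<^sub>v q) = c * meval F q" if q: "q \<in> carrier_vec (m + 1)" for q
  proof (cases "\<exists>\<tau>. q + \<tau> \<cdot>\<^sub>v p = 0\<^sub>v (m + 1)")
    \<comment> \<open>Here \<open>q\<close> is a multiple of \<open>p\<close>, and homogeneity of
      both forms settles it.\<close>
    case True
    then obtain \<tau> where "q + \<tau> \<cdot>\<^sub>v p = 0\<^sub>v (m + 1)"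
      by blast
    then have "q = (- \<tau>) \<cdot>\<^sub>v p"
      using p(1) q by (auto simp: vec_eq_iff add_eq_0_iff2)
    moreover have "A *\<^sub>v ((- \<tau>) \<cdot>\<^sub>v p) = (- \<tau>) \<cdot>\<^sub>v (A *\<^sub>v p)"
      using A p(1) by (rule mult_mat_vec)
    ultimately show ?thesis
      using p Ac by (simp only: meval_smult[OF homG] meval_smult[OF hom]) (simp add: c_def)
  next
    case False
    obtain v where v: "v \<in> carrier_vec (m + 1)"
      and fin: "finite {\<epsilon>. \<not> rsquarefree (line_restriction F (q + \<epsilon> \<cdot>\<^sub>v v) p)}"
      using generic_line_squarefree[OF smooth p q] False by blast
    \<comment> \<open>The line through \<open>q\<close> itself need not be squarefree.
      \<open>D\<close> measures the failure along the deformation; it vanishes for all but finitely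
      many \<open>\<epsilon>\<close>, hence also at 0.\<close>
    define D where "D = line_restriction G (A *\<^sub>v q) (A *\<^sub>v v) - smult c (line_restriction F q v)"
    have D: "poly D \<epsilon> = meval G (A *\<^sub>v (q + \<epsilon> \<cdot>\<^sub>v v)) - c * meval F (q + \<epsilon> \<cdot>\<^sub>v v)" for \<epsilon>
      using q v Ac by (simp add: D_def poly_line_restriction[OF hom] poly_line_restriction[OF homG] A_line)
    have "poly D \<epsilon> = 0" if "rsquarefree (line_restriction F (q + \<epsilon> \<cdot>\<^sub>v v) p)" for \<epsilon>
    proof -
      define x where "x = q + \<epsilon> \<cdot>\<^sub>v v"
      have x: "x \<in> carrier_vec (m + 1)"
        using q v by (simp add: x_def)
      have deg: "degree (line_restriction F x p) = d"
        using degree_line_restriction[OF hom, of x p] p(2) by (metis antisym le_degree)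
      have "line_restriction G (A *\<^sub>v x) (A *\<^sub>v p) = smult c (line_restriction F x p)"
      proof (rule eq_smult_if_roots_subset)
        show "rsquarefree (line_restriction F x p)"
          using that by (simp add: x_def)
        show "degree (line_restriction G (A *\<^sub>v x) (A *\<^sub>v p)) \<le> degree (line_restriction F x p)"
          unfolding deg by (rule degree_line_restriction[OF homG])
        show "coeff (line_restriction G (A *\<^sub>v x) (A *\<^sub>v p)) (degree (line_restriction F x p))
            = c * lead_coeff (line_restriction F x p)"
          unfolding deg degree_line_restriction(2)[OF homG] degree_line_restriction(2)[OF hom]
          using p(2) by (simp add: c_def)
      next
        fix t assume "poly (line_restriction F x p) t = 0"
        then have "meval F (x + t \<cdot>\<^sub>v p) = 0"
          using x p by (simp add: poly_line_restriction[OF hom])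
        then have "meval G (A *\<^sub>v (x + t \<cdot>\<^sub>v p)) = 0"
          using x p by (intro van) auto
        then show "poly (line_restriction G (A *\<^sub>v x) (A *\<^sub>v p)) t = 0"
          using x p Ac by (simp add: poly_line_restriction[OF homG] A_line)
      qed
      then have "poly (line_restriction G (A *\<^sub>v x) (A *\<^sub>v p)) 0 = c * poly (line_restriction F x p) 0"
        by simp
      moreover have "x + 0 \<cdot>\<^sub>v p = x" "A *\<^sub>v x + 0 \<cdot>\<^sub>v (A *\<^sub>v p) = A *\<^sub>v x"
        using x p(1) Ac by auto
      ultimately show ?thesis
        using x p Ac D
        by (simp add: x_def[symmetric] poly_line_restriction[OF homG] poly_line_restriction[OF hom])
    qed
    then have "UNIV \<subseteq> {\<epsilon>. \<not> rsquarefree (line_restriction F (q + \<epsilon> \<cdot>\<^sub>v v) p)} \<union> {\<epsilon>. poly D \<epsilon> = 0}"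
      by auto
    then have "infinite {\<epsilon>. poly D \<epsilon> = 0}"
      using fin infinite_UNIV_char_0 by (metis finite_Un finite_subset)
    then have "D = 0"
      using poly_roots_finite by blast
    moreover have "q + 0 \<cdot>\<^sub>v v = q"
      using q v by auto
    ultimately show ?thesis
      using D[of 0] by simp
  qed
  then show ?thesis
    by (rule that)
qed

subsection \<open>Projective equivalence and linear maps\<close>

lemma invertible_mat_iff:
  assumes "A \<in> carrier_mat n n"
  shows "invertible_mat A \<longleftrightarrow> (\<exists>B\<in>carrier_mat n n. A * B = 1\<^sub>m n \<and> B * A = 1\<^sub>m n)"
proof
  assume "invertible_mat A"
  then obtain B where B: "A * B = 1\<^sub>m (dim_row A)" "B * A = 1\<^sub>m (dim_row B)"
    by (auto simp: invertible_mat_def inverts_mat_def)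
  from arg_cong[OF B(1), of dim_col] arg_cong[OF B(2), of dim_col] assms have "B \<in> carrier_mat n n"
    by auto
  with B assms show "\<exists>B\<in>carrier_mat n n. A * B = 1\<^sub>m n \<and> B * A = 1\<^sub>m n"
    by auto
next
  assume "\<exists>B\<in>carrier_mat n n. A * B = 1\<^sub>m n \<and> B * A = 1\<^sub>m n"
  then show "invertible_mat A"
    using assms by (auto simp: invertible_mat_def inverts_mat_def square_mat.simps)
qed

lemma invertible_mat_if_trivial_kernel:
  fixes A :: "'k::field mat"
  assumes A: "A \<in> carrier_mat n n"
    and "\<And>x. x \<in> carrier_vec n \<Longrightarrow> A *\<^sub>v x = 0\<^sub>v n \<Longrightarrow> x = 0\<^sub>v n"
  shows "invertible_mat A"
proof -
  have "det A \<noteq> 0"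
    using assms det_0_iff_vec_prod_zero_field[OF A] by blast
  from det_non_zero_imp_unit[OF A this, of "()"] show ?thesis
    unfolding invertible_mat_iff[OF A] Units_def by (auto simp: ring_mat_def)
qed

lemma invertible_matE:
  fixes A :: "'k::field mat"
  assumes "invertible_mat A" "A \<in> carrier_mat n n"
  obtains B where "B \<in> carrier_mat n n" "invertible_mat B"
    "\<And>x. x \<in> carrier_vec n \<Longrightarrow> A *\<^sub>v (B *\<^sub>v x) = x" "\<And>x. x \<in> carrier_vec n \<Longrightarrow> B *\<^sub>v (A *\<^sub>v x) = x"
proof -
  obtain B where B: "B \<in> carrier_mat n n" "A * B = 1\<^sub>m n" "B * A = 1\<^sub>m n"
    using assms invertible_mat_iff by blast
  show ?thesis
  proof (rule that[OF B(1)])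
    show "invertible_mat B"
      using B assms(2) invertible_mat_iff by blast
    show "A *\<^sub>v (B *\<^sub>v x) = x" if "x \<in> carrier_vec n" for x
      using assoc_mult_mat_vec[OF assms(2) B(1) that] B that by simp
    show "B *\<^sub>v (A *\<^sub>v x) = x" if "x \<in> carrier_vec n" for x
      using assoc_mult_mat_vec[OF B(1) assms(2) that] B that by simp
  qed
qed

text \<open>Reflections, extensions and truncations are handled as functions on vectors; a matrix is
  extracted only when \<open>proj_equivalent\<close> demands one.\<close>

definition linear_op :: "nat \<Rightarrow> ('k::field vec \<Rightarrow> 'k vec) \<Rightarrow> bool" where
  "linear_op n L \<longleftrightarrow>
     (\<forall>x\<in>carrier_vec n. L x \<in> carrier_vec n) \<and>
     (\<forall>x\<in>carrier_vec n. \<forall>y\<in>carrier_vec n. L (x + y) = L x + L y) \<and>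
     (\<forall>c. \<forall>x\<in>carrier_vec n. L (c \<cdot>\<^sub>v x) = c \<cdot>\<^sub>v L x)"

lemma linear_opD:
  assumes "linear_op n L" "x \<in> carrier_vec n"
  shows "L x \<in> carrier_vec n" "L (c \<cdot>\<^sub>v x) = c \<cdot>\<^sub>v L x"
    "y \<in> carrier_vec n \<Longrightarrow> L (x + y) = L x + L y"
  using assms by (simp_all add: linear_op_def)

lemma linear_op_0:
  assumes "linear_op n L"
  shows "L (0\<^sub>v n) = 0\<^sub>v n"
proof -
  have zero: "0 \<cdot>\<^sub>v y = 0\<^sub>v n" if "y \<in> carrier_vec n" for y :: "'a vec"
    using smult_vec_eq_0_iff[OF that] by simp
  have "L (0 \<cdot>\<^sub>v 0\<^sub>v n) = 0 \<cdot>\<^sub>v L (0\<^sub>v n)"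
    using linear_opD(2)[OF assms zero_carrier_vec] .
  then show ?thesis
    by (simp only: zero[OF zero_carrier_vec] zero[OF linear_opD(1)[OF assms zero_carrier_vec]])
qed

lemma linear_op_mat:
  fixes A :: "'k::field mat"
  assumes "A \<in> carrier_mat n n"
  shows "linear_op n (\<lambda>x. A *\<^sub>v x)"
  using assms by (auto simp: linear_op_def mult_add_distrib_mat_vec mult_mat_vec)

lemma smult_zero_vec: "c \<cdot>\<^sub>v 0\<^sub>v n = (0\<^sub>v n :: 'k::field vec)"
  by (simp add: vec_eq_iff)

lemma linear_op_matrix:
  assumes L: "linear_op n L"
  obtains A where "A \<in> carrier_mat n n" "\<And>x. x \<in> carrier_vec n \<Longrightarrow> A *\<^sub>v x = L x"
proof -
  define A where "A = mat n n (\<lambda>(i, j). L (unit_vec n j) $ i)"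
  have A: "A \<in> carrier_mat n n"
    by (simp add: A_def)
  have "A *\<^sub>v x = L x" if x: "x \<in> carrier_vec n" for x
  proof -
    \<comment> \<open>Both sides are linear and agree on unit vectors; \<open>x\<close> is built up
      one coordinate at a time.\<close>
    have prefix: "k \<le> n \<Longrightarrow> A *\<^sub>v vec n (\<lambda>i. if i < k then x $ i else 0) = L (vec n (\<lambda>i. if i < k then x $ i else 0))" for k
    proof (induction k)
      case 0
      have "vec n (\<lambda>i. if i < 0 then x $ i else 0) = 0\<^sub>v n"
        by (auto simp: vec_eq_iff)
      then show ?case
        using linear_op_0[OF L] linear_op_0[OF linear_op_mat[OF A]] by simp
    next
      case (Suc k)
      then have k: "k < n"
        by simp
      define y where "y = vec n (\<lambda>i. if i < k then x $ i else 0)"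
      have y: "y \<in> carrier_vec n"
        by (simp add: y_def)
      have split: "vec n (\<lambda>i. if i < Suc k then x $ i else 0) = y + x $ k \<cdot>\<^sub>v unit_vec n k"
        using k by (auto simp: y_def vec_eq_iff less_Suc_eq)
      have "A *\<^sub>v unit_vec n k = L (unit_vec n k)"
      proof (rule eq_vecI)
        have Lc: "L (unit_vec n k) \<in> carrier_vec n"
          using L by (simp add: linear_op_def)
        then show "dim_vec (A *\<^sub>v unit_vec n k) = dim_vec (L (unit_vec n k))"
          using A by simp
        show "(A *\<^sub>v unit_vec n k) $ i = L (unit_vec n k) $ i" if "i < dim_vec (L (unit_vec n k))" for i
          using that Lc k A by (simp add: A_def)
      qed
      moreover have "A *\<^sub>v y = L y"
        unfolding y_def using Suc.IH k by simp
      ultimately show ?case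
        unfolding split
        by (simp only: linear_opD[OF L] linear_opD[OF linear_op_mat[OF A]] y unit_vec_carrier smult_carrier_vec)
    qed
    have "vec n (\<lambda>i. if i < n then x $ i else 0) = x"
      using x by (auto simp: vec_eq_iff)
    with prefix[of n] show ?thesis
      by simp
  qed
  with A show ?thesis
    by (rule that)
qed

lemma linear_op_comp:
  assumes "linear_op n L" "linear_op n M"
  shows "linear_op n (\<lambda>x. L (M x))"
  using assms by (auto simp: linear_op_def)

lemma proj_map_point:
  assumes A: "A \<in> carrier_mat (m + 1) (m + 1)" and x: "x \<in> carrier_vec (m + 1)" "x \<noteq> 0\<^sub>v (m + 1)"
    and "A *\<^sub>v x \<noteq> 0\<^sub>v (m + 1)"
  shows "proj_map A (point m x) = point m (A *\<^sub>v x)"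
proof -
  have "A *\<^sub>v x \<in> carrier_vec (m + 1)"
    using A x by simp
  note iff = mem_point_iff[OF x] mem_point_iff[OF this assms(4)]
  show ?thesis
  proof (rule Set.set_eqI)
    fix y
    have "y \<in> proj_map A (point m x) \<longleftrightarrow> (\<exists>c. c \<noteq> 0 \<and> y = A *\<^sub>v (c \<cdot>\<^sub>v x))"
      unfolding proj_map_def image_iff Bex_def iff by blast
    then show "y \<in> proj_map A (point m x) \<longleftrightarrow> y \<in> point m (A *\<^sub>v x)"
      unfolding iff mult_mat_vec[OF A x(1)] .
  qed
qed

text \<open>An invertible matrix is injective on points as well as vectors, so equality of the image
  with the second locus amounts to an equivalence at each vector.\<close>

lemma proj_equivalent_zero_locus_iff:
  fixes F G :: "'k::field mpoly"
  assumes hom: "homogeneous m d F" "homogeneous m d G" and "d > 0"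
  shows "proj_equivalent m (zero_locus m F) (zero_locus m G) \<longleftrightarrow>
    (\<exists>A\<in>carrier_mat (m + 1) (m + 1). invertible_mat A \<and>
       (\<forall>x\<in>carrier_vec (m + 1). meval F x = 0 \<longleftrightarrow> meval G (A *\<^sub>v x) = 0))"
proof -
  have key: "proj_map A ` zero_locus m F = zero_locus m G \<longleftrightarrow>
      (\<forall>x\<in>carrier_vec (m + 1). meval F x = 0 \<longleftrightarrow> meval G (A *\<^sub>v x) = 0)" (is "?lhs \<longleftrightarrow> ?rhs")
    if A: "A \<in> carrier_mat (m + 1) (m + 1)" "invertible_mat A" for A
  proof -
    obtain B where B: "B \<in> carrier_mat (m + 1) (m + 1)" "invertible_mat B"
      "\<And>x. x \<in> carrier_vec (m + 1) \<Longrightarrow> A *\<^sub>v (B *\<^sub>v x) = x" "\<And>x. x \<in> carrier_vec (m + 1) \<Longrightarrow> B *\<^sub>v (A *\<^sub>v x) = x"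
      by (rule invertible_matE[OF A(2,1)], rule that)
    have zero: "M *\<^sub>v 0\<^sub>v (m + 1) = 0\<^sub>v (m + 1)" if "M \<in> carrier_mat (m + 1) (m + 1)" for M :: "'k mat"
      by (rule linear_op_0[OF linear_op_mat[OF that]])
    have A_nz: "A *\<^sub>v x \<noteq> 0\<^sub>v (m + 1)" if "x \<in> carrier_vec (m + 1)" "x \<noteq> 0\<^sub>v (m + 1)" for x
    proof
      assume "A *\<^sub>v x = 0\<^sub>v (m + 1)"
      with B(4)[OF that(1)] zero[OF B(1)] that(2) show False
        by simp
    qed
    have B_nz: "B *\<^sub>v x \<noteq> 0\<^sub>v (m + 1)" if "x \<in> carrier_vec (m + 1)" "x \<noteq> 0\<^sub>v (m + 1)" for x
    proof
      assume "B *\<^sub>v x = 0\<^sub>v (m + 1)"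
      with B(3)[OF that(1)] zero[OF A(1)] that(2) show False
        by simp
    qed
    have Ac: "A *\<^sub>v x \<in> carrier_vec (m + 1)" "B *\<^sub>v x \<in> carrier_vec (m + 1)" if "x \<in> carrier_vec (m + 1)" for x
      using mult_mat_vec_carrier[OF A(1) that] mult_mat_vec_carrier[OF B(1) that] by blast+
    \<comment> \<open>The criterion also quantifies over the zero vector, which represents no point;
      positive degree makes both forms vanish there.\<close>
    have at_0: "meval H (0\<^sub>v (m + 1)) = 0" if "homogeneous m d H" for H :: "'k mpoly"
      using meval_smult[OF that zero_carrier_vec, of 0] \<open>d > 0\<close>
      by (simp only: zero_power mult_zero_left smult_zero_vec)
    show ?thesis
    proof
      assume eq: ?lhs
      show ?rhs
      proof
        fix x :: "'k vec" assume x: "x \<in> carrier_vec (m + 1)"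
        show "meval F x = 0 \<longleftrightarrow> meval G (A *\<^sub>v x) = 0"
        proof (cases "x = 0\<^sub>v (m + 1)")
          case True
          then show ?thesis
            using at_0[OF hom(1)] at_0[OF hom(2)] zero[OF A(1)] by simp
        next
          case False
          note pm = proj_map_point[OF A(1) x False A_nz[OF x False]]
          have "meval F x = 0 \<longleftrightarrow> point m x \<in> zero_locus m F"
            using point_mem_zero_locus_iff[OF hom(1) x False] by simp
          also have "\<dots> \<longleftrightarrow> point m (A *\<^sub>v x) \<in> zero_locus m G"
          proof
            assume "point m x \<in> zero_locus m F"
            then show "point m (A *\<^sub>v x) \<in> zero_locus m G"
              unfolding eq[symmetric] pm[symmetric] by (rule imageI)
          next
            assume "point m (A *\<^sub>v x) \<in> zero_locus m G"
            then obtain P where P: "P \<in> zero_locus m F" "proj_map A P = point m (A *\<^sub>v x)"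
              unfolding eq[symmetric] by blast
            then have "A *\<^sub>v x \<in> proj_map A P"
              using self_mem_point[OF Ac(1)[OF x] A_nz[OF x False]] by simp
            \<comment> \<open>Equality of image classes only provides some representative
              \<open>z\<close> of \<open>P\<close> with the same image as \<open>x\<close>;
              injectivity of \<open>A\<close> identifies it with \<open>x\<close>.\<close>
            then obtain z where z: "z \<in> P" "A *\<^sub>v x = A *\<^sub>v z"
              by (auto simp: proj_map_def)
            from P(1) obtain y where y: "y \<in> carrier_vec (m + 1)" "y \<noteq> 0\<^sub>v (m + 1)" "P = point m y"
              unfolding zero_locus_eq[OF hom(1)] by auto
            with z have "z \<in> carrier_vec (m + 1)"
              using mem_point_iff[OF y(1,2)] by auto
            then have "x = z"
              using z(2) B(4)[of z] B(4)[OF x] by simp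
            then have "meval F x = 0"
              using z(1) P(1) by (auto simp: zero_locus_def)
            then show "point m x \<in> zero_locus m F"
              using point_mem_zero_locus_iff[OF hom(1) x False] by simp
          qed
          also have "\<dots> \<longleftrightarrow> meval G (A *\<^sub>v x) = 0"
            using point_mem_zero_locus_iff[OF hom(2) Ac(1)[OF x] A_nz[OF x False]] .
          finally show ?thesis .
        qed
      qed
    next
      assume eq: ?rhs
      have "proj_map A ` zero_locus m F = (\<lambda>x. point m (A *\<^sub>v x)) ` {x \<in> carrier_vec (m + 1). x \<noteq> 0\<^sub>v (m + 1) \<and> meval F x = 0}"
        unfolding zero_locus_eq[OF hom(1)] image_image
        by (rule image_cong[OF refl], rule proj_map_point[OF A(1)]) (use A_nz in blast)+
      also have "\<dots> = point m ` {x \<in> carrier_vec (m + 1). x \<noteq> 0\<^sub>v (m + 1) \<and> meval G x = 0}"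
      proof (intro equalityI subsetI)
        fix P assume "P \<in> point m ` {x \<in> carrier_vec (m + 1). x \<noteq> 0\<^sub>v (m + 1) \<and> meval G x = 0}"
        then obtain x where x: "x \<in> carrier_vec (m + 1)" "x \<noteq> 0\<^sub>v (m + 1)" "meval G x = 0" "P = point m x"
          by blast
        then show "P \<in> (\<lambda>x. point m (A *\<^sub>v x)) ` {x \<in> carrier_vec (m + 1). x \<noteq> 0\<^sub>v (m + 1) \<and> meval F x = 0}"
          using eq B(3)[OF x(1)] Ac(2)[OF x(1)] B_nz[OF x(1,2)] by (intro image_eqI[of _ _ "B *\<^sub>v x"]) auto
      next
        fix P assume "P \<in> (\<lambda>x. point m (A *\<^sub>v x)) ` {x \<in> carrier_vec (m + 1). x \<noteq> 0\<^sub>v (m + 1) \<and> meval F x = 0}"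
        then obtain x where x: "x \<in> carrier_vec (m + 1)" "x \<noteq> 0\<^sub>v (m + 1)" "meval F x = 0" "P = point m (A *\<^sub>v x)"
          by blast
        then show "P \<in> point m ` {x \<in> carrier_vec (m + 1). x \<noteq> 0\<^sub>v (m + 1) \<and> meval G x = 0}"
          using eq Ac(1)[OF x(1)] A_nz[OF x(1,2)] by blast
      qed
      finally show ?lhs
        unfolding zero_locus_eq[OF hom(2)] .
    qed
  qed
  show ?thesis
  proof
    assume "proj_equivalent m (zero_locus m F) (zero_locus m G)"
    then obtain A where A: "A \<in> carrier_mat (m + 1) (m + 1)" "invertible_mat A"
      "proj_map A ` zero_locus m F = zero_locus m G"
      unfolding proj_equivalent_def by (elim exE conjE)
    from key[OF A(1,2)] A show "\<exists>A\<in>carrier_mat (m + 1) (m + 1). invertible_mat A \<and>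
       (\<forall>x\<in>carrier_vec (m + 1). meval F x = 0 \<longleftrightarrow> meval G (A *\<^sub>v x) = 0)"
      by blast
  next
    assume "\<exists>A\<in>carrier_mat (m + 1) (m + 1). invertible_mat A \<and>
       (\<forall>x\<in>carrier_vec (m + 1). meval F x = 0 \<longleftrightarrow> meval G (A *\<^sub>v x) = 0)"
    then obtain A where A: "A \<in> carrier_mat (m + 1) (m + 1)" "invertible_mat A"
      "\<forall>x\<in>carrier_vec (m + 1). meval F x = 0 \<longleftrightarrow> meval G (A *\<^sub>v x) = 0"
      by (elim bexE conjE)
    from key[OF A(1,2)] A show "proj_equivalent m (zero_locus m F) (zero_locus m G)"
      unfolding proj_equivalent_def by blast
  qed
qed

subsection \<open>Cyclic covers\<close>

lemma linear_op_invertible_matrix: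
  assumes L: "linear_op n L" and "\<And>x. x \<in> carrier_vec n \<Longrightarrow> L x = 0\<^sub>v n \<Longrightarrow> x = 0\<^sub>v n"
  obtains A where "A \<in> carrier_mat n n" "invertible_mat A" "\<And>x. x \<in> carrier_vec n \<Longrightarrow> A *\<^sub>v x = L x"
proof -
  obtain A where A: "A \<in> carrier_mat n n" "\<And>x. x \<in> carrier_vec n \<Longrightarrow> A *\<^sub>v x = L x"
    using linear_op_matrix[OF L] by blast
  have "invertible_mat A"
    by (rule invertible_mat_if_trivial_kernel[OF A(1)]) (simp add: A(2) assms(2))
  with A show ?thesis
    using that by blast
qed

text \<open>Forgets the cover coordinate: vectors for the cover have \<open>m + 1 + 1\<close>
  entries, and index \<open>m + 1\<close> is the last one.\<close>

definition trunc_vec :: "nat \<Rightarrow> 'a vec \<Rightarrow> 'a vec" where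
  "trunc_vec m x = vec m (\<lambda>i. x $ i)"

lemma trunc_vec_carrier [simp]: "trunc_vec m x \<in> carrier_vec m"
  by (simp add: trunc_vec_def)

lemma index_trunc_vec [simp]: "i < m \<Longrightarrow> trunc_vec m x $ i = x $ i"
  by (simp add: trunc_vec_def)

lemma vec_eq_0_if_trunc:
  assumes "x \<in> carrier_vec (m + 1 + 1)" "trunc_vec (m + 1) x = 0\<^sub>v (m + 1)" "x $ (m + 1) = 0"
  shows "x = 0\<^sub>v (m + 1 + 1)"
proof (rule eq_vecI)
  fix i assume "i < dim_vec (0\<^sub>v (m + 1 + 1) :: 'a vec)"
  then consider "i = m + 1" | "i < m + 1"
    by fastforce
  then show "x $ i = 0\<^sub>v (m + 1 + 1) $ i"
  proof cases
    case 2
    then show ?thesis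
      using arg_cong[OF assms(2), of "\<lambda>z. z $ i"] by simp
  qed (use assms(3) in simp)
qed (use assms(1) in simp)

lemma homogeneous_mono:
  assumes "homogeneous m d F" "m \<le> m'"
  shows "homogeneous m' d F"
  using assms by (fastforce simp: homogeneous_def)

lemma homogeneous_cover:
  assumes "homogeneous m d F"
  shows "homogeneous (m + 1) d (mvar (m + 1) ^ d - F)"
proof -
  have "Poly_Mapping.keys (mvar (m + 1) ^ d - F)
      \<subseteq> Poly_Mapping.keys (mvar (m + 1) ^ d :: 'a mpoly) \<union> Poly_Mapping.keys F"
    by (auto simp: in_keys_iff lookup_minus)
  also have "\<dots> \<subseteq> {Poly_Mapping.single (m + 1) d} \<union> Poly_Mapping.keys F"
    by (auto simp: mvar_power)
  finally have "a = Poly_Mapping.single (m + 1) d \<or> a \<in> Poly_Mapping.keys F"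
    if "a \<in> Poly_Mapping.keys (mvar (m + 1) ^ d - F)" for a
    using that by blast
  then show ?thesis
    using homogeneous_mono[OF assms, of "m + 1"]
    unfolding homogeneous_def by (fastforce split: if_splits)
qed

lemma meval_cover: "meval (mvar i ^ d - F) x = (x $ i) ^ d - meval F x"
  by (simp add: meval_eq_msubst msubst_diff[OF comm_ring_hom_id] msubst_mvar_power[OF comm_ring_hom_id])

lemma line_restriction_cover:
  "line_restriction (mvar i ^ d - F) x v = [:x $ i, v $ i:] ^ d - line_restriction F x v"
  by (simp add: line_restriction_def msubst_diff[OF comm_ring_hom_const] msubst_mvar_power[OF comm_ring_hom_const])

text \<open>Partial derivatives of \<open>mvar i ^ d - F\<close> can thus be computed in one
  variable, where the restriction of the power is explicit.\<close>

lemma meval_mderiv: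
  fixes F :: "'k::field mpoly"
  assumes "homogeneous m d F" "i \<le> m"
  shows "meval (mderiv i F) x = poly (pderiv (line_restriction F x (unit_vec (m + 1) i))) 0"
proof -
  have "(\<Sum>j\<le>m. unit_vec (m + 1) i $ j * meval (mderiv j F) x)
      = (\<Sum>j\<in>{i}. unit_vec (m + 1) i $ j * meval (mderiv j F) x)"
    using assms(2) by (intro sum.mono_neutral_right) auto
  then show ?thesis
    using assms(2) by (simp add: pderiv_line_restriction[OF assms(1)])
qed

text \<open>Off the branch locus the derivative in the cover coordinate is
  \<open>d * x^(d-1)\<close>, nonzero in characteristic 0. On it the point lies on the base
  hypersurface, whose own Jacobian applies.\<close>

lemma smooth_cover:
  fixes F :: "'k::field_char_0 mpoly"
  assumes smooth: "smooth_form m d F" and "d > 0"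
  shows "smooth_form (m + 1) d (mvar (m + 1) ^ d - F)"
proof (rule smooth_formI)
  let ?H = "mvar (m + 1) ^ d - F"
  have hom: "homogeneous m d F"
    using smooth by (simp add: smooth_form_def)
  show homH: "homogeneous (m + 1) d ?H"
    by (rule homogeneous_cover[OF hom])
  have "Poly_Mapping.single (m + 1) d \<notin> Poly_Mapping.keys F"
    using hom \<open>d > 0\<close> by (fastforce simp: homogeneous_def)
  then have "Poly_Mapping.lookup ?H (Poly_Mapping.single (m + 1) d) = 1"
    by (simp add: lookup_minus mvar_power in_keys_iff)
  then show "?H \<noteq> 0"
    by auto
  fix x :: "'k vec"
  assume x: "x \<in> carrier_vec (m + 1 + 1)" "x \<noteq> 0\<^sub>v (m + 1 + 1)" and "meval ?H x = 0"
  then have eq: "(x $ (m + 1)) ^ d = meval F x"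
    by (simp add: meval_cover)
  show "\<exists>i\<le>m + 1. meval (mderiv i ?H) x \<noteq> 0"
  proof (cases "x $ (m + 1) = 0")
    case False
    have "meval (mderiv (m + 1) ?H) x = of_nat d * (x $ (m + 1)) ^ (d - 1)
        - poly (pderiv (line_restriction F x (unit_vec (m + 1 + 1) (m + 1)))) 0"
      by (subst meval_mderiv[OF homH])
        (simp_all add: line_restriction_cover pderiv_diff pderiv_power pderiv_pCons)
    also have "poly (pderiv (line_restriction F x (unit_vec (m + 1 + 1) (m + 1)))) 0 = 0"
      unfolding pderiv_line_restriction[OF hom] by (rule sum.neutral) simp
    finally show ?thesis
      using False \<open>d > 0\<close> by (intro exI[of _ "m + 1"]) simp
  next
    case True
    let ?y = "trunc_vec (m + 1) x"
    have y: "?y \<in> carrier_vec (m + 1)"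
      by simp
    have "?y \<noteq> 0\<^sub>v (m + 1)"
      using vec_eq_0_if_trunc[OF x(1) _ True] x(2) by blast
    moreover have "meval F ?y = 0"
      using eq True \<open>d > 0\<close> meval_cong[OF hom, of ?y x] by (simp add: zero_power)
    ultimately obtain i where i: "i \<le> m" "meval (mderiv i F) ?y \<noteq> 0"
      using smooth_formD[OF smooth y] by blast
    \<comment> \<open>\<open>F\<close> involves only the first \<open>m + 1\<close> coordinates;
      moreover the power is constant along a base direction, so only \<open>- F\<close> contributes
      to the derivative.\<close>
    have "line_restriction F x (unit_vec (m + 1 + 1) i) = line_restriction F ?y (unit_vec (m + 1) i)"
      unfolding line_restriction_def by (rule msubst_cong[OF hom]) (use i(1) in auto)
    then have "meval (mderiv i ?H) x = - meval (mderiv i F) ?y"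
      using i(1)
      by (subst meval_mderiv[OF homH], simp, subst meval_mderiv[OF hom])
        (simp_all add: line_restriction_cover pderiv_diff pderiv_power pderiv_pCons)
    with i show ?thesis
      by (intro exI[of _ i]) simp
  qed
qed

lemma equivalent_forms_proportional:
  fixes F G :: "'k::{alg_closed_field, field_char_0} mpoly"
  assumes F: "smooth_form m d F" and G: "smooth_form m d G" and "d > 0"
    and equiv: "proj_equivalent m (zero_locus m F) (zero_locus m G)"
  obtains A c where "A \<in> carrier_mat (m + 1) (m + 1)" "invertible_mat A" "c \<noteq> 0"
    "\<And>x. x \<in> carrier_vec (m + 1) \<Longrightarrow> meval G (A *\<^sub>v x) = c * meval F x"
proof -
  have hom: "homogeneous m d F" "homogeneous m d G"
    using F G by (simp_all add: smooth_form_def)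
  obtain A where A: "A \<in> carrier_mat (m + 1) (m + 1)" "invertible_mat A"
    and iff: "\<And>x. x \<in> carrier_vec (m + 1) \<Longrightarrow> meval F x = 0 \<longleftrightarrow> meval G (A *\<^sub>v x) = 0"
    using equiv unfolding proj_equivalent_zero_locus_iff[OF hom \<open>d > 0\<close>] by blast
  obtain c where c: "\<And>x. x \<in> carrier_vec (m + 1) \<Longrightarrow> meval G (A *\<^sub>v x) = c * meval F x"
    using form_proportional_if_vanishes_on_smooth[OF F hom(2) A(1)] iff by blast
  obtain p where "p \<in> carrier_vec (m + 1)" "meval F p \<noteq> 0"
    using smooth_form_nonvanishing[OF F] .
  \<comment> \<open>The converse direction of \<open>iff\<close>, at a vector where \<open>F\<close>
    does not vanish.\<close>
  then have "c \<noteq> 0"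
    using iff c by fastforce
  then show ?thesis
    using that A c by blast
qed

lemma proj_equivalentI_linear_op:
  fixes F G :: "'k::field mpoly"
  assumes hom: "homogeneous m d F" "homogeneous m d G" and "d > 0"
    and L: "linear_op (m + 1) L" "\<And>x. x \<in> carrier_vec (m + 1) \<Longrightarrow> L x = 0\<^sub>v (m + 1) \<Longrightarrow> x = 0\<^sub>v (m + 1)"
    and eq: "\<And>x. x \<in> carrier_vec (m + 1) \<Longrightarrow> meval G (L x) = c * meval F x" and "c \<noteq> 0"
  shows "proj_equivalent m (zero_locus m F) (zero_locus m G)"
proof -
  obtain A where A: "A \<in> carrier_mat (m + 1) (m + 1)" "invertible_mat A"
    "\<And>x. x \<in> carrier_vec (m + 1) \<Longrightarrow> A *\<^sub>v x = L x"
    using linear_op_invertible_matrix[OF L] by blast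
  have "\<forall>x\<in>carrier_vec (m + 1). meval F x = 0 \<longleftrightarrow> meval G (A *\<^sub>v x) = 0"
    using A(3) eq \<open>c \<noteq> 0\<close> by simp
  with A(1,2) show ?thesis
    unfolding proj_equivalent_zero_locus_iff[OF hom \<open>d > 0\<close>] by blast
qed

text \<open>This makes the map on classes well defined, also when different equations are chosen for
  the same hypersurface.\<close>

lemma cover_equivalent:
  fixes F G :: "'k::{alg_closed_field, field_char_0} mpoly"
  assumes F: "smooth_form m d F" and G: "smooth_form m d G" and "d > 0"
    and equiv: "proj_equivalent m (zero_locus m F) (zero_locus m G)"
  shows "proj_equivalent (m + 1) (zero_locus (m + 1) (mvar (m + 1) ^ d - F))
    (zero_locus (m + 1) (mvar (m + 1) ^ d - G))"
proof -
  have hom: "homogeneous m d F" "homogeneous m d G"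
    using F G by (simp_all add: smooth_form_def)
  obtain A c where A: "A \<in> carrier_mat (m + 1) (m + 1)" "invertible_mat A" and "c \<noteq> 0"
    and eq: "\<And>x. x \<in> carrier_vec (m + 1) \<Longrightarrow> meval G (A *\<^sub>v x) = c * meval F x"
    using equivalent_forms_proportional[OF assms] by blast
  obtain \<gamma> where \<gamma>: "\<gamma> ^ d = c"
    using nth_root_exists[OF \<open>d > 0\<close>] by blast
  then have "\<gamma> \<noteq> 0"
    using \<open>c \<noteq> 0\<close> \<open>d > 0\<close> by auto
  \<comment> \<open>\<open>A\<close> multiplies the form by \<open>c\<close>; scaling the cover
    coordinate by \<open>\<gamma>\<close> multiplies its \<open>d\<close>-th power by the same
    \<open>c\<close>.\<close>
  define L where "L x = vec (m + 1 + 1) (\<lambda>i. if i < m + 1 then (A *\<^sub>v trunc_vec (m + 1) x) $ i else \<gamma> * x $ (m + 1))" for x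
  have trunc: "trunc_vec (m + 1) (L x) = A *\<^sub>v trunc_vec (m + 1) x" for x
    using A(1) by (auto simp: L_def trunc_vec_def vec_eq_iff)
  have last: "L x $ (m + 1) = \<gamma> * x $ (m + 1)" for x
    by (simp add: L_def)
  note linA = linear_opD[OF linear_op_mat[OF A(1)] trunc_vec_carrier]
  show ?thesis
  proof (rule proj_equivalentI_linear_op[OF homogeneous_cover[OF hom(1)] homogeneous_cover[OF hom(2)] \<open>d > 0\<close>])
    show "linear_op (m + 1 + 1) L"
      unfolding linear_op_def
    proof (intro conjI ballI allI)
      fix x y :: "'k vec" assume xy: "x \<in> carrier_vec (m + 1 + 1)" "y \<in> carrier_vec (m + 1 + 1)"
      have "trunc_vec (m + 1) (x + y) = trunc_vec (m + 1) x + trunc_vec (m + 1) y"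
        using xy by (auto simp: trunc_vec_def vec_eq_iff)
      then have "A *\<^sub>v trunc_vec (m + 1) (x + y) = A *\<^sub>v trunc_vec (m + 1) x + A *\<^sub>v trunc_vec (m + 1) y"
        using linA(3)[OF trunc_vec_carrier] by simp
      then show "L (x + y) = L x + L y"
        using xy A(1) by (auto simp: L_def vec_eq_iff distrib_left)
    next
      fix a and x :: "'k vec" assume x: "x \<in> carrier_vec (m + 1 + 1)"
      have "trunc_vec (m + 1) (a \<cdot>\<^sub>v x) = a \<cdot>\<^sub>v trunc_vec (m + 1) x"
        using x by (auto simp: trunc_vec_def vec_eq_iff)
      then have "A *\<^sub>v trunc_vec (m + 1) (a \<cdot>\<^sub>v x) = a \<cdot>\<^sub>v (A *\<^sub>v trunc_vec (m + 1) x)"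
        using linA(2) by simp
      then show "L (a \<cdot>\<^sub>v x) = a \<cdot>\<^sub>v L x"
        using x A(1) by (auto simp: L_def vec_eq_iff)
    qed (simp add: L_def)
  next
    fix x :: "'k vec" assume x: "x \<in> carrier_vec (m + 1 + 1)" "L x = 0\<^sub>v (m + 1 + 1)"
    have "x $ (m + 1) = 0"
      using last[of x] x(2) \<open>\<gamma> \<noteq> 0\<close> by simp
    moreover obtain B where B: "B \<in> carrier_mat (m + 1) (m + 1)"
      "B *\<^sub>v (A *\<^sub>v trunc_vec (m + 1) x) = trunc_vec (m + 1) x"
      using A trunc_vec_carrier by (metis invertible_matE)
    have "A *\<^sub>v trunc_vec (m + 1) x = 0\<^sub>v (m + 1)"
      unfolding trunc[symmetric] x(2) by (auto simp: trunc_vec_def vec_eq_iff)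
    with B have "trunc_vec (m + 1) x = 0\<^sub>v (m + 1)"
      using linear_op_0[OF linear_op_mat[OF B(1)]] by simp
    ultimately show "x = 0\<^sub>v (m + 1 + 1)"
      by (intro vec_eq_0_if_trunc[OF x(1)])
  next
    fix x :: "'k vec"
    have "meval G (L x) = meval G (trunc_vec (m + 1) (L x))"
      by (rule meval_cong[OF hom(2)]) simp
    also have "\<dots> = c * meval F (trunc_vec (m + 1) x)"
      unfolding trunc by (rule eq) simp
    also have "meval F (trunc_vec (m + 1) x) = meval F x"
      by (rule meval_cong[OF hom(1)]) simp
    finally show "meval (mvar (m + 1) ^ d - G) (L x) = c * meval (mvar (m + 1) ^ d - F) x"
      unfolding meval_cover last by (simp add: power_mult_distrib \<gamma> algebra_simps)
  qed (rule \<open>c \<noteq> 0\<close>)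
qed

subsection \<open>Recovering the branch hypersurface\<close>

lemma poly_ext:
  fixes p q :: "'a::{idom, ring_char_0} poly"
  assumes "\<And>x. poly p x = poly q x"
  shows "p = q"
  using assms poly_eq_poly_eq_iff by blast

text \<open>Both sides of the assumption are polynomial in \<open>s\<close> and \<open>t\<close>,
  and the claim compares their coefficients of \<open>s * t\<close>. For \<open>d = 2\<close> the
  exponent is 0 and the relation reads \<open>a = b\<close>.\<close>

lemma power_translation_cross_relation:
  fixes x1 x2 a b :: "'k::field_char_0"
  assumes "d \<ge> 2"
    and "\<And>s t. (x1 + s) ^ d - x1 ^ d + ((x2 + b * s + t) ^ d - (x2 + b * s) ^ d)
          = (x2 + t) ^ d - x2 ^ d + ((x1 + a * t + s) ^ d - (x1 + a * t) ^ d)"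
  shows "a * x1 ^ (d - 2) = b * x2 ^ (d - 2)"
proof -
  \<comment> \<open>Derivative with respect to \<open>t\<close> at 0 with \<open>s\<close> fixed,
    divided by \<open>d\<close>.\<close>
  have dt: "(x2 + b * s) ^ (d - 1) = x2 ^ (d - 1) + a * (x1 + s) ^ (d - 1) - a * x1 ^ (d - 1)" for s
  proof -
    have "[:(x1 + s) ^ d - x1 ^ d - (x2 + b * s) ^ d:] + [:x2 + b * s, 1:] ^ d
        = [:x2, 1:] ^ d - [:x2 ^ d:] + ([:x1 + s, a:] ^ d - [:x1, a:] ^ d)"
      by (rule poly_ext) (use assms(2)[of s] in \<open>simp add: algebra_simps\<close>)
    then have "poly (pderiv ([:(x1 + s) ^ d - x1 ^ d - (x2 + b * s) ^ d:] + [:x2 + b * s, 1:] ^ d)) 0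
        = poly (pderiv ([:x2, 1:] ^ d - [:x2 ^ d:] + ([:x1 + s, a:] ^ d - [:x1, a:] ^ d))) 0"
      by simp
    then have "of_nat d * (x2 + b * s) ^ (d - 1)
        = of_nat d * (x2 ^ (d - 1) + a * (x1 + s) ^ (d - 1) - a * x1 ^ (d - 1))"
      by (simp add: pderiv_add pderiv_diff pderiv_power pderiv_pCons algebra_simps)
    then show ?thesis
      using assms(1) by (subst (asm) mult_cancel_left) auto
  qed
  \<comment> \<open>The second derivative, now with respect to \<open>s\<close> at 0; the factor
    \<open>d - 1\<close> is positive and cancels.\<close>
  have "[:x2, b:] ^ (d - 1) = [:x2 ^ (d - 1) - a * x1 ^ (d - 1):] + smult a ([:x1, 1:] ^ (d - 1))"
    by (rule poly_ext) (use dt in \<open>simp add: algebra_simps\<close>)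
  then have "poly (pderiv ([:x2, b:] ^ (d - 1))) 0
      = poly (pderiv ([:x2 ^ (d - 1) - a * x1 ^ (d - 1):] + smult a ([:x1, 1:] ^ (d - 1)))) 0"
    by simp
  then have "of_nat (d - 1) * (b * x2 ^ (d - 2)) = of_nat (d - 1) * (a * x1 ^ (d - 2))"
    by (simp add: pderiv_add pderiv_smult pderiv_power pderiv_pCons algebra_simps numeral_2_eq_2)
  then show ?thesis
    using assms(1) by (subst (asm) mult_cancel_left) auto
qed

definition linear_functional :: "nat \<Rightarrow> ('k::field vec \<Rightarrow> 'k) \<Rightarrow> bool" where
  "linear_functional n l \<longleftrightarrow>
     (\<forall>x\<in>carrier_vec n. \<forall>y\<in>carrier_vec n. l (x + y) = l x + l y) \<and>
     (\<forall>c. \<forall>x\<in>carrier_vec n. l (c \<cdot>\<^sub>v x) = c * l x)"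

lemma linear_functionalD:
  assumes "linear_functional n l" "x \<in> carrier_vec n"
  shows "l (c \<cdot>\<^sub>v x) = c * l x" "y \<in> carrier_vec n \<Longrightarrow> l (x + y) = l x + l y"
  using assms by (simp_all add: linear_functional_def)

text \<open>Equivalently, \<open>l^d - f\<close> is invariant under translation along
  \<open>e\<close>: up to a linear change of coordinates, \<open>f\<close> is a cyclic cover with
  coordinate \<open>l\<close> and projection centre \<open>e\<close>. Stated for functions, it is
  easily transported by linear operators.\<close>

definition power_translation :: "nat \<Rightarrow> nat \<Rightarrow> ('k::field vec \<Rightarrow> 'k) \<Rightarrow> ('k vec \<Rightarrow> 'k) \<Rightarrow> 'k vec \<Rightarrow> bool" where
  "power_translation n d f l e \<longleftrightarrow> e \<in> carrier_vec n \<and> linear_functional n l \<and> l e = 1 \<and>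
     (\<forall>x\<in>carrier_vec n. \<forall>t. f (x + t \<cdot>\<^sub>v e) = f x + ((l x + t) ^ d - l x ^ d))"

lemma power_translationD:
  assumes "power_translation n d f l e"
  shows "e \<in> carrier_vec n" "linear_functional n l" "l e = 1"
    "x \<in> carrier_vec n \<Longrightarrow> f (x + t \<cdot>\<^sub>v e) = f x + ((l x + t) ^ d - l x ^ d)"
  using assms by (simp_all add: power_translation_def)

lemma power_translation_relation:
  fixes f :: "'k::field_char_0 vec \<Rightarrow> 'k"
  assumes "d \<ge> 2" and 1: "power_translation n d f l1 e1" and 2: "power_translation n d f l2 e2"
    and x: "x \<in> carrier_vec n"
  shows "l1 e2 * l1 x ^ (d - 2) = l2 e1 * l2 x ^ (d - 2)"
proof (rule power_translation_cross_relation[OF \<open>d \<ge> 2\<close>])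
  fix s t
  note e = power_translationD(1)[OF 1] power_translationD(1)[OF 2]
  have "f (x + s \<cdot>\<^sub>v e1 + t \<cdot>\<^sub>v e2) = f (x + t \<cdot>\<^sub>v e2 + s \<cdot>\<^sub>v e1)"
    using x e by (intro arg_cong[of _ _ f]) (auto simp: vec_eq_iff)
  \<comment> \<open>The second translation starts at \<open>x + s \<cdot>\<^sub>v e1\<close>, where
    \<open>l2\<close> has already moved by \<open>l2 e1 * s\<close>.\<close>
  moreover have "f (x + s \<cdot>\<^sub>v e1 + t \<cdot>\<^sub>v e2) = f x + ((l1 x + s) ^ d - l1 x ^ d)
      + ((l2 x + l2 e1 * s + t) ^ d - (l2 x + l2 e1 * s) ^ d)"
    using x e power_translationD(4)[OF 2, of "x + s \<cdot>\<^sub>v e1" t] power_translationD(4)[OF 1 x, of s]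
    by (simp add: linear_functionalD[OF power_translationD(2)[OF 2]] mult.commute)
  moreover have "f (x + t \<cdot>\<^sub>v e2 + s \<cdot>\<^sub>v e1) = f x + ((l2 x + t) ^ d - l2 x ^ d)
      + ((l1 x + l1 e2 * t + s) ^ d - (l1 x + l1 e2 * t) ^ d)"
    using x e power_translationD(4)[OF 1, of "x + t \<cdot>\<^sub>v e2" s] power_translationD(4)[OF 2 x, of t]
    by (simp add: linear_functionalD[OF power_translationD(2)[OF 1]] mult.commute)
  ultimately show "(l1 x + s) ^ d - l1 x ^ d + ((l2 x + l2 e1 * s + t) ^ d - (l2 x + l2 e1 * s) ^ d)
      = (l2 x + t) ^ d - l2 x ^ d + ((l1 x + l1 e2 * t + s) ^ d - (l1 x + l1 e2 * t) ^ d)"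
    by (simp add: algebra_simps)
qed

text \<open>For \<open>d = 2\<close> this is the orthogonal reflection exchanging \<open>e\<^sub>1\<close> and \<open>e\<^sub>2\<close>.\<close>

lemma power_translation_reflection:
  assumes 1: "power_translation n d f l1 e1" and 2: "power_translation n d f l2 e2"
    and sym: "l1 e2 = l2 e1" and "l1 e2 \<noteq> 1"
  obtains B where "linear_op n B" "\<And>x. x \<in> carrier_vec n \<Longrightarrow> f (B x) = f x"
    "\<And>x. x \<in> carrier_vec n \<Longrightarrow> l2 (B x) = l1 x"
    "\<And>x. x \<in> carrier_vec n \<Longrightarrow> B x = 0\<^sub>v n \<Longrightarrow> x = 0\<^sub>v n"
proof -
  \<comment> \<open>By \<open>sym\<close>, moving by \<open>u x\<close> along \<open>e2 - e1\<close>
    raises \<open>l2\<close> and lowers \<open>l1\<close> by \<open>u x * (1 - l1 e2)\<close>; this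
    \<open>u\<close> makes the change exactly \<open>l1 x - l2 x\<close>.\<close>
  define u where "u x = (l1 x - l2 x) / (1 - l1 e2)" for x
  define B where "B x = x + (- u x) \<cdot>\<^sub>v e1 + u x \<cdot>\<^sub>v e2" for x
  note e = power_translationD(1)[OF 1] power_translationD(1)[OF 2]
  note l1 = linear_functionalD[OF power_translationD(2)[OF 1]] power_translationD(3)[OF 1]
  note l2 = linear_functionalD[OF power_translationD(2)[OF 2]] power_translationD(3)[OF 2]
  have u: "u x * (1 - l1 e2) = l1 x - l2 x" for x
    using assms(4) by (simp add: u_def)
  have u_add: "u (x + y) = u x + u y" if "x \<in> carrier_vec n" "y \<in> carrier_vec n" for x y
    using that by (simp add: u_def l1 l2 add_divide_distrib[symmetric] algebra_simps)
  have u_smult: "u (c \<cdot>\<^sub>v x) = c * u x" if "x \<in> carrier_vec n" for c x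
    using that by (simp add: u_def l1 l2 algebra_simps)
  have Bc: "B x \<in> carrier_vec n" if "x \<in> carrier_vec n" for x
    using that e by (simp add: B_def)
  have l2B: "l2 (B x) = l1 x" if "x \<in> carrier_vec n" for x
    using that e u[of x] by (simp add: B_def l2 sym algebra_simps)
  have l1B: "l1 (B x) = l2 x" if "x \<in> carrier_vec n" for x
    using that e u[of x] by (simp add: B_def l1 sym algebra_simps)
  show ?thesis
  proof (rule that)
    show "linear_op n B"
      unfolding linear_op_def
    proof (intro conjI ballI allI)
      fix x y :: "'a vec" assume "x \<in> carrier_vec n" "y \<in> carrier_vec n"
      then show "B (x + y) = B x + B y"
        using e u_add by (auto simp: B_def vec_eq_iff algebra_simps)
    next
      fix c and x :: "'a vec" assume "x \<in> carrier_vec n"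
      then show "B (c \<cdot>\<^sub>v x) = c \<cdot>\<^sub>v B x"
        using e u_smult by (auto simp: B_def vec_eq_iff algebra_simps)
    qed (rule Bc)
    show "f (B x) = f x" if x: "x \<in> carrier_vec n" for x
    proof -
      \<comment> \<open>At the intermediate point both functionals equal \<open>l1 x - u x\<close>,
        so the two changes of \<open>f\<close> cancel.\<close>
      let ?y = "x + (- u x) \<cdot>\<^sub>v e1"
      have "l2 ?y = l1 x - u x"
        using x e u[of x] by (simp add: l2 sym algebra_simps)
      then have "f (B x) = f ?y + (l1 x ^ d - (l1 x - u x) ^ d)"
        using x e power_translationD(4)[OF 2, of ?y "u x"] by (simp add: B_def)
      also have "f ?y = f x + ((l1 x - u x) ^ d - l1 x ^ d)"
        using power_translationD(4)[OF 1 x, of "- u x"] by simp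
      finally show ?thesis
        by simp
    qed
    show "l2 (B x) = l1 x" if "x \<in> carrier_vec n" for x
      using that by (rule l2B)
    \<comment> \<open>\<open>B\<close> exchanges \<open>l1\<close> and \<open>l2\<close>, so both
      vanish on its kernel; there \<open>u\<close> is 0 and \<open>B\<close> fixes the
      vector.\<close>
    show "x = 0\<^sub>v n" if x: "x \<in> carrier_vec n" and "B x = 0\<^sub>v n" for x
    proof -
      have l0: "l (0\<^sub>v n) = 0" if "linear_functional n l" for l :: "'a vec \<Rightarrow> 'a"
        using linear_functionalD(1)[OF that zero_carrier_vec, of 0] by (simp only: smult_zero_vec mult_zero_left)
      have "l1 x = 0" "l2 x = 0"
        using l2B[OF x] l1B[OF x] that(2) l0[OF power_translationD(2)[OF 1]] l0[OF power_translationD(2)[OF 2]]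
        by simp_all
      then have "u x = 0"
        by (simp add: u_def)
      then have "B x = x"
        using x e by (auto simp: B_def vec_eq_iff)
      with that(2) show ?thesis
        by simp
    qed
  qed
qed

text \<open>A square does not see the sign of \<open>l\<close>; the flip serves to leave the
  excluded case \<open>l1 e2 = 1\<close> of the reflection.\<close>

lemma power_translation_square_uminus:
  assumes "power_translation n 2 f l e"
  shows "power_translation n 2 f (\<lambda>x. - l x) ((- 1) \<cdot>\<^sub>v e)"
proof -
  note D = power_translationD[OF assms]
  have "f (x + t \<cdot>\<^sub>v ((- 1) \<cdot>\<^sub>v e)) = f x + ((- l x + t)\<^sup>2 - (- l x)\<^sup>2)" if "x \<in> carrier_vec n" for x t
  proof -
    have "t \<cdot>\<^sub>v ((- 1) \<cdot>\<^sub>v e) = (- t) \<cdot>\<^sub>v e"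
      by (simp add: vec_eq_iff)
    then show ?thesis
      using D(4)[OF that, of "- t"] by (simp add: power2_eq_square algebra_simps)
  qed
  then show ?thesis
    using D(1,3) linear_functionalD[OF D(2)] by (simp add: power_translation_def linear_functional_def)
qed

text \<open>The case split rests on the relation at the vectors \<open>e1\<close> and
  \<open>e2\<close>, where one of the functionals is 1.\<close>

lemma power_translation_hyperplanes_equivalent:
  fixes f :: "'k::field_char_0 vec \<Rightarrow> 'k"
  assumes "d \<ge> 2" and 1: "power_translation n d f l1 e1" and 2: "power_translation n d f l2 e2"
  obtains B where "linear_op n B" "\<And>x. x \<in> carrier_vec n \<Longrightarrow> f (B x) = f x"
    "\<And>x. x \<in> carrier_vec n \<Longrightarrow> l1 x = 0 \<Longrightarrow> l2 (B x) = 0"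
    "\<And>x. x \<in> carrier_vec n \<Longrightarrow> B x = 0\<^sub>v n \<Longrightarrow> x = 0\<^sub>v n"
proof -
  note rel = power_translation_relation[OF assms]
  note e = power_translationD(1)[OF 1] power_translationD(1)[OF 2]
  consider "d = 2" | "d > 2" "l1 e2 \<noteq> 0" | "d > 2" "l1 e2 = 0"
    using assms(1) by linarith
  then show ?thesis
  proof cases
    case 1
    with rel[OF e(1)] have sym: "l1 e2 = l2 e1"
      by simp
    show ?thesis
    proof (cases "l1 e2 = 1")
      case False
      show ?thesis
        using power_translation_reflection[OF assms(2,3) sym False] that by metis
    next
      case True
      \<comment> \<open>After flipping the second pair the common value \<open>l1 e2\<close> becomes
        -1, and the reflection exists; the sign does not affect the hyperplane.\<close>
      note neg = power_translation_square_uminus[OF assms(3)[unfolded \<open>d = 2\<close>]]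
      have "l1 ((- 1) \<cdot>\<^sub>v e2) = - 1"
        using linear_functionalD(1)[OF power_translationD(2)[OF assms(2)] e(2)] True by simp
      moreover have "(- 1 :: 'k) \<noteq> 1"
        using one_neq_neg_one by metis
      ultimately obtain B where "linear_op n B" "\<And>x. x \<in> carrier_vec n \<Longrightarrow> f (B x) = f x"
        "\<And>x. x \<in> carrier_vec n \<Longrightarrow> - l2 (B x) = l1 x"
        "\<And>x. x \<in> carrier_vec n \<Longrightarrow> B x = 0\<^sub>v n \<Longrightarrow> x = 0\<^sub>v n"
        using power_translation_reflection[OF assms(2)[unfolded \<open>d = 2\<close>] neg] True sym by metis
      then show ?thesis
        using that[of B] by (metis neg_equal_0_iff_equal)
    qed
  next
    case 2
    have "l2 x = 0" if "x \<in> carrier_vec n" "l1 x = 0" for x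
    proof -
      \<comment> \<open>At \<open>e1\<close> the relation reads
        \<open>l1 e2 = (l2 e1)^(d-1)\<close>. With both constants nonzero, \<open>l1 x = 0\<close>
        forces \<open>l2 x = 0\<close>, and the identity serves as \<open>B\<close>.\<close>
      have "l2 e1 \<noteq> 0"
        using rel[OF e(1)] 2 power_translationD(3)[OF assms(2)] by auto
      then show ?thesis
        using rel[OF that(1)] that(2) 2(1) by (simp add: zero_power)
    qed
    then show ?thesis
      using that[of "\<lambda>x. x"] by (simp add: linear_op_def)
  next
    case 3
    \<comment> \<open>At \<open>e2\<close> the relation reads \<open>(l1 e2)^(d-1) = l2 e1\<close>,
      so both constants vanish and the reflection applies.\<close>
    have "l2 e1 = 0"
      using rel[OF e(2)] 3 power_translationD(3)[OF assms(3)] by simp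
    then have sym: "l1 e2 = l2 e1" and "l1 e2 \<noteq> 1"
      using 3 by simp_all
    show ?thesis
      using power_translation_reflection[OF assms(2,3) sym \<open>l1 e2 \<noteq> 1\<close>] that by metis
  qed
qed

lemma power_translation_cover:
  fixes F :: "'k::field mpoly"
  assumes hom: "homogeneous m d F"
  shows "power_translation (m + 1 + 1) d (meval (mvar (m + 1) ^ d - F)) (\<lambda>x. x $ (m + 1)) (unit_vec (m + 1 + 1) (m + 1))"
proof -
  have "meval F (x + t \<cdot>\<^sub>v unit_vec (m + 1 + 1) (m + 1)) = meval F x" if "x \<in> carrier_vec (m + 1 + 1)" for x t
    using that by (intro meval_cong[OF hom]) simp
  then show ?thesis
    by (simp add: power_translation_def linear_functional_def meval_cover)
qed

lemma power_translation_transfer: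
  assumes pt: "power_translation n d g l e" and L: "linear_op n L"
    and f: "\<And>x. x \<in> carrier_vec n \<Longrightarrow> g (L x) = f x"
    and e': "e' \<in> carrier_vec n" "L e' = e"
  shows "power_translation n d f (\<lambda>x. l (L x)) e'"
proof -
  note D = power_translationD[OF pt] and l = linear_functionalD[OF power_translationD(2)[OF pt]] and Lx = linear_opD[OF L]
  have "f (x + t \<cdot>\<^sub>v e') = f x + ((l (L x) + t) ^ d - l (L x) ^ d)" if x: "x \<in> carrier_vec n" for x t
  proof -
    have "x + t \<cdot>\<^sub>v e' \<in> carrier_vec n"
      using x e' by simp
    from f[OF this, symmetric] show ?thesis
      using x e' D(4)[OF Lx(1)[OF x]] by (simp add: Lx f)
  qed
  then show ?thesis
    using e' D(3) by (simp add: power_translation_def linear_functional_def Lx l)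
qed

text \<open>On the hyperplanes where the cover coordinates vanish, the cover equations are
  \<open>- F\<close> and \<open>- G\<close>. The correction \<open>C\<close> makes the equivalence
  respect these hyperplanes.\<close>

lemma forms_equivalent_if_covers_equivalent:
  fixes F G :: "'k::{alg_closed_field, field_char_0} mpoly"
  assumes F: "smooth_form m d F" and G: "smooth_form m d G" and d: "d \<ge> 2"
    and equiv: "proj_equivalent (m + 1) (zero_locus (m + 1) (mvar (m + 1) ^ d - F))
      (zero_locus (m + 1) (mvar (m + 1) ^ d - G))"
  shows "proj_equivalent m (zero_locus m F) (zero_locus m G)"
proof -
  let ?F = "mvar (m + 1) ^ d - F" and ?G = "mvar (m + 1) ^ d - G" and ?N = "m + 1 + 1"
  have "d > 0"
    using d by simp
  have hom: "homogeneous m d F" "homogeneous m d G"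
    using F G by (simp_all add: smooth_form_def)
  obtain A c where A: "A \<in> carrier_mat ?N ?N" "invertible_mat A" and "c \<noteq> 0"
    and eq: "\<And>x. x \<in> carrier_vec ?N \<Longrightarrow> meval ?G (A *\<^sub>v x) = c * meval ?F x"
    using equivalent_forms_proportional[OF smooth_cover[OF F \<open>d > 0\<close>] smooth_cover[OF G \<open>d > 0\<close>] \<open>d > 0\<close> equiv] by blast
  obtain B where B: "B \<in> carrier_mat ?N ?N" "invertible_mat B"
    "\<And>x. x \<in> carrier_vec ?N \<Longrightarrow> A *\<^sub>v (B *\<^sub>v x) = x" "\<And>x. x \<in> carrier_vec ?N \<Longrightarrow> B *\<^sub>v (A *\<^sub>v x) = x"
    by (rule invertible_matE[OF A(2,1)], rule that)
  obtain \<gamma> where \<gamma>: "\<gamma> ^ d = c"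
    using nth_root_exists[OF \<open>d > 0\<close>] by blast
  then have "\<gamma> \<noteq> 0"
    using \<open>c \<noteq> 0\<close> \<open>d > 0\<close> by auto
  \<comment> \<open>Rescaling by \<open>inverse \<gamma>\<close> divides values by \<open>c\<close>,
    so \<open>L\<close> pulls \<open>?G\<close> back to \<open>?F\<close> exactly.\<close>
  define L where "L x = A *\<^sub>v (inverse \<gamma> \<cdot>\<^sub>v x)" for x
  have L: "linear_op ?N L"
    unfolding L_def
    by (rule linear_op_comp[OF linear_op_mat[OF A(1)]]) (auto simp: linear_op_def vec_eq_iff algebra_simps)
  have L_eq: "meval ?G (L x) = meval ?F x" if "x \<in> carrier_vec ?N" for x
    using that \<gamma> \<open>c \<noteq> 0\<close> unfolding L_def
    by (simp only: eq smult_carrier_vec meval_smult[OF homogeneous_cover[OF hom(1)]])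
      (simp add: power_inverse)
  have L_kernel: "x = 0\<^sub>v ?N" if x: "x \<in> carrier_vec ?N" "L x = 0\<^sub>v ?N" for x
  proof -
    have "inverse \<gamma> \<cdot>\<^sub>v x = B *\<^sub>v L x"
      unfolding L_def using x(1) by (intro B(4)[symmetric]) simp
    then have "inverse \<gamma> \<cdot>\<^sub>v x = 0\<^sub>v ?N"
      unfolding x(2) linear_op_0[OF linear_op_mat[OF B(1)]] .
    then show ?thesis
      using \<open>\<gamma> \<noteq> 0\<close> smult_vec_eq_0_iff[OF x(1)] by auto
  qed
  let ?e = "unit_vec ?N (m + 1) :: 'k vec"
  \<comment> \<open>The preimage under \<open>L\<close> of the translation vector \<open>?e\<close>
    of the second cover.\<close>
  define e2 where "e2 = \<gamma> \<cdot>\<^sub>v (B *\<^sub>v ?e)"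
  have Be: "B *\<^sub>v ?e \<in> carrier_vec ?N"
    using mult_mat_vec_carrier[OF B(1) unit_vec_carrier] .
  have e2: "e2 \<in> carrier_vec ?N"
    unfolding e2_def using Be by (rule smult_carrier_vec[THEN iffD2])
  have "inverse \<gamma> \<cdot>\<^sub>v e2 = B *\<^sub>v ?e"
    using \<open>\<gamma> \<noteq> 0\<close> by (simp add: e2_def smult_smult_assoc)
  then have Le2: "L e2 = ?e"
    unfolding L_def by (simp only: B(3) unit_vec_carrier)
  have 1: "power_translation ?N d (meval ?F) (\<lambda>x. x $ (m + 1)) ?e"
    by (rule power_translation_cover[OF hom(1)])
  have 2: "power_translation ?N d (meval ?F) (\<lambda>x. L x $ (m + 1)) e2"
    by (rule power_translation_transfer[OF power_translation_cover[OF hom(2)] L L_eq e2 Le2])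
  obtain C where C: "linear_op ?N C" "\<And>x. x \<in> carrier_vec ?N \<Longrightarrow> meval ?F (C x) = meval ?F x"
    "\<And>x. x \<in> carrier_vec ?N \<Longrightarrow> x $ (m + 1) = 0 \<Longrightarrow> L (C x) $ (m + 1) = 0"
    "\<And>x. x \<in> carrier_vec ?N \<Longrightarrow> C x = 0\<^sub>v ?N \<Longrightarrow> x = 0\<^sub>v ?N"
    by (rule power_translation_hyperplanes_equivalent[OF d 1 2], rule that)
  define ext where "ext x = vec ?N (\<lambda>i. if i < m + 1 then x $ i else 0)" for x :: "'k vec"
  have ext: "ext x \<in> carrier_vec ?N" "ext x $ (m + 1) = 0" for x
    by (simp_all add: ext_def)
  \<comment> \<open>Embed the base as the hyperplane \<open>x $ (m + 1) = 0\<close>, correct by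
    \<open>C\<close>, then apply \<open>L\<close>; the image again has last coordinate 0, so
    truncating it loses nothing.\<close>
  define M where "M x = L (C (ext x))" for x
  have lin: "linear_op ?N (\<lambda>x. L (C x))"
    by (rule linear_op_comp[OF L C(1)])
  note Mx = linear_opD[OF lin ext(1), folded M_def]
  have M_last: "M x $ (m + 1) = 0" for x
    unfolding M_def by (rule C(3)[OF ext])
  show ?thesis
  proof (rule proj_equivalentI_linear_op[OF hom \<open>d > 0\<close>])
    show "linear_op (m + 1) (\<lambda>x. trunc_vec (m + 1) (M x))"
      unfolding linear_op_def
    proof (intro conjI ballI allI)
      fix x y :: "'k vec" assume "x \<in> carrier_vec (m + 1)" "y \<in> carrier_vec (m + 1)"
      then have "ext (x + y) = ext x + ext y"
        by (auto simp: ext_def vec_eq_iff)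
      then have "M (x + y) = M x + M y"
        using Mx(3)[OF ext(1), folded M_def] by (simp add: M_def)
      then show "trunc_vec (m + 1) (M (x + y)) = trunc_vec (m + 1) (M x) + trunc_vec (m + 1) (M y)"
        using Mx(1)[of x] Mx(1)[of y] by (auto simp: trunc_vec_def vec_eq_iff)
    next
      fix a and x :: "'k vec" assume "x \<in> carrier_vec (m + 1)"
      then have "ext (a \<cdot>\<^sub>v x) = a \<cdot>\<^sub>v ext x"
        by (auto simp: ext_def vec_eq_iff)
      then have "M (a \<cdot>\<^sub>v x) = a \<cdot>\<^sub>v M x"
        using Mx(2)[of a x] by (simp add: M_def)
      then show "trunc_vec (m + 1) (M (a \<cdot>\<^sub>v x)) = a \<cdot>\<^sub>v trunc_vec (m + 1) (M x)"
        using Mx(1)[of x] by (auto simp: trunc_vec_def vec_eq_iff)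
    qed simp
  next
    fix x :: "'k vec" assume x: "x \<in> carrier_vec (m + 1)" "trunc_vec (m + 1) (M x) = 0\<^sub>v (m + 1)"
    have "M x = 0\<^sub>v ?N"
      by (rule vec_eq_0_if_trunc[OF Mx(1) x(2) M_last])
    then have ext0: "ext x = 0\<^sub>v ?N"
      using C(4)[OF ext(1)] L_kernel[OF linear_opD(1)[OF C(1) ext(1)]] by (simp add: M_def)
    have "x $ i = 0" if "i < m + 1" for i
      using that arg_cong[OF ext0, of "\<lambda>z. z $ i"] by (simp add: ext_def)
    then show "x = 0\<^sub>v (m + 1)"
      using x(1) by (auto simp: vec_eq_iff)
  next
    fix x :: "'k vec"
    have "meval G (trunc_vec (m + 1) (M x)) = meval G (M x)"
      by (rule meval_cong[OF hom(2)]) simp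
    also have "\<dots> = - meval ?G (M x)"
      using \<open>d > 0\<close> by (simp add: meval_cover M_last[simplified] zero_power)
    also have "meval ?G (M x) = meval ?F (ext x)"
      unfolding M_def by (simp only: L_eq C(2) linear_opD(1)[OF C(1)] ext(1))
    also have "- \<dots> = meval F (ext x)"
      using \<open>d > 0\<close> by (simp add: meval_cover ext(2)[simplified] zero_power)
    also have "\<dots> = meval F x"
      by (rule meval_cong[OF hom(1)]) (simp add: ext_def)
    finally show "meval G (trunc_vec (m + 1) (M x)) = 1 * meval F x"
      by simp
  qed simp
qed

section \<open>Classes of hypersurfaces and the induced map on moduli\<close>

lemma smooth_hypersurfacesE:
  assumes "Y \<in> smooth_hypersurfaces m d"
  obtains F where "smooth_form m d F" "Y = zero_locus m F"
  using assms by (auto simp: smooth_hypersurfaces_def)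

lemma invertible_mat_mult:
  fixes A B :: "'k::field mat"
  assumes A: "A \<in> carrier_mat n n" "invertible_mat A" and B: "B \<in> carrier_mat n n" "invertible_mat B"
  shows "invertible_mat (A * B)"
proof (rule invertible_mat_if_trivial_kernel[OF mult_carrier_mat[OF A(1) B(1)]])
  fix x assume x: "x \<in> carrier_vec n" "A * B *\<^sub>v x = 0\<^sub>v n"
  obtain A' where A': "A' \<in> carrier_mat n n" "invertible_mat A'"
    "\<And>x. x \<in> carrier_vec n \<Longrightarrow> A *\<^sub>v (A' *\<^sub>v x) = x" "\<And>x. x \<in> carrier_vec n \<Longrightarrow> A' *\<^sub>v (A *\<^sub>v x) = x"
    by (rule invertible_matE[OF A(2,1)], rule that)
  obtain B' where B': "B' \<in> carrier_mat n n" "invertible_mat B'"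
    "\<And>x. x \<in> carrier_vec n \<Longrightarrow> B *\<^sub>v (B' *\<^sub>v x) = x" "\<And>x. x \<in> carrier_vec n \<Longrightarrow> B' *\<^sub>v (B *\<^sub>v x) = x"
    by (rule invertible_matE[OF B(2,1)], rule that)
  have "A *\<^sub>v (B *\<^sub>v x) = 0\<^sub>v n"
    using x(2) assoc_mult_mat_vec[OF A(1) B(1) x(1)] by simp
  then have "B *\<^sub>v x = 0\<^sub>v n"
    using A'(4)[OF mult_mat_vec_carrier[OF B(1) x(1)]] linear_op_0[OF linear_op_mat[OF A'(1)]] by simp
  then show "x = 0\<^sub>v n"
    using B'(4)[OF x(1)] linear_op_0[OF linear_op_mat[OF B'(1)]] by simp
qed

lemma equiv_proj_equivalent:
  assumes "d > 0"
  shows "equiv (smooth_hypersurfaces m d)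
    {(Y1, Y2). Y1 \<in> smooth_hypersurfaces m d \<and> Y2 \<in> smooth_hypersurfaces m d \<and>
       proj_equivalent m Y1 (Y2 :: 'k::field vec set set)}" (is "equiv ?S ?r")
proof -
  have iff: "proj_equivalent m (zero_locus m F) (zero_locus m G) \<longleftrightarrow>
    (\<exists>A\<in>carrier_mat (m + 1) (m + 1). invertible_mat A \<and>
       (\<forall>x\<in>carrier_vec (m + 1). meval F x = 0 \<longleftrightarrow> meval G (A *\<^sub>v x) = 0))"
    if "smooth_form m d F" "smooth_form m d G" for F G :: "'k mpoly"
    using that assms by (intro proj_equivalent_zero_locus_iff) (simp_all add: smooth_form_def)
  have refl: "proj_equivalent m Y Y" if "Y \<in> ?S" for Y
  proof -
    from that obtain F where F: "smooth_form m d F" "Y = zero_locus m F"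
      by (rule smooth_hypersurfacesE)
    have "invertible_mat (1\<^sub>m (m + 1) :: 'k mat)"
      unfolding invertible_mat_iff[OF one_carrier_mat] by (intro bexI[of _ "1\<^sub>m (m + 1)"]) simp_all
    then show ?thesis
      unfolding F(2) iff[OF F(1) F(1)] by (intro bexI[of _ "1\<^sub>m (m + 1)"]) simp_all
  qed
  have sym: "proj_equivalent m Z Y" if "Y \<in> ?S" "Z \<in> ?S" "proj_equivalent m Y Z" for Y Z
  proof -
    from that(1) obtain F where F: "smooth_form m d F" "Y = zero_locus m F"
      by (rule smooth_hypersurfacesE)
    from that(2) obtain G where G: "smooth_form m d G" "Z = zero_locus m G"
      by (rule smooth_hypersurfacesE)
    from that(3) obtain A where A: "A \<in> carrier_mat (m + 1) (m + 1)" "invertible_mat A"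
      and eq: "\<And>x. x \<in> carrier_vec (m + 1) \<Longrightarrow> meval F x = 0 \<longleftrightarrow> meval G (A *\<^sub>v x) = 0"
      unfolding F(2) G(2) iff[OF F(1) G(1)] by blast
    obtain B where B: "B \<in> carrier_mat (m + 1) (m + 1)" "invertible_mat B"
      "\<And>x. x \<in> carrier_vec (m + 1) \<Longrightarrow> A *\<^sub>v (B *\<^sub>v x) = x" "\<And>x. x \<in> carrier_vec (m + 1) \<Longrightarrow> B *\<^sub>v (A *\<^sub>v x) = x"
      by (rule invertible_matE[OF A(2,1)], rule that)
    have "meval G x = 0 \<longleftrightarrow> meval F (B *\<^sub>v x) = 0" if "x \<in> carrier_vec (m + 1)" for x
      using eq[OF mult_mat_vec_carrier[OF B(1) that]] by (simp only: B(3)[OF that])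
    with B(1,2) show ?thesis
      unfolding F(2) G(2) iff[OF G(1) F(1)] by blast
  qed
  have trans: "proj_equivalent m X Z"
    if "X \<in> ?S" "Y \<in> ?S" "Z \<in> ?S" "proj_equivalent m X Y" "proj_equivalent m Y Z" for X Y Z
  proof -
    from that(1) obtain F where F: "smooth_form m d F" "X = zero_locus m F"
      by (rule smooth_hypersurfacesE)
    from that(2) obtain G where G: "smooth_form m d G" "Y = zero_locus m G"
      by (rule smooth_hypersurfacesE)
    from that(3) obtain H where H: "smooth_form m d H" "Z = zero_locus m H"
      by (rule smooth_hypersurfacesE)
    from that(4) obtain A where A: "A \<in> carrier_mat (m + 1) (m + 1)" "invertible_mat A"
      and eqA: "\<And>x. x \<in> carrier_vec (m + 1) \<Longrightarrow> meval F x = 0 \<longleftrightarrow> meval G (A *\<^sub>v x) = 0"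
      unfolding F(2) G(2) iff[OF F(1) G(1)] by blast
    from that(5) obtain B where B: "B \<in> carrier_mat (m + 1) (m + 1)" "invertible_mat B"
      and eqB: "\<And>x. x \<in> carrier_vec (m + 1) \<Longrightarrow> meval G x = 0 \<longleftrightarrow> meval H (B *\<^sub>v x) = 0"
      unfolding G(2) H(2) iff[OF G(1) H(1)] by blast
    have "meval F x = 0 \<longleftrightarrow> meval H (B * A *\<^sub>v x) = 0" if "x \<in> carrier_vec (m + 1)" for x
      using eqA[OF that] eqB[OF mult_mat_vec_carrier[OF A(1) that]]
      by (simp only: assoc_mult_mat_vec[OF B(1) A(1) that])
    moreover have "invertible_mat (B * A)"
      by (rule invertible_mat_mult[OF B(1,2) A])
    ultimately show ?thesis
      unfolding F(2) H(2) iff[OF F(1) H(1)] using mult_carrier_mat[OF B(1) A(1)] by blast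
  qed
  show ?thesis
    by (intro equivI refl_onI symI transI) (auto intro: refl sym trans)
qed

lemma equiv_moduli_rel:
  assumes "d > 0"
  shows "equiv (smooth_hypersurfaces (n + 1) d) (moduli_rel n d)"
  using equiv_proj_equivalent[OF assms, of "n + 1"] by (simp add: moduli_rel_def)

theorem theorem1p1:
  fixes n d :: nat
  assumes "n \<ge> 2" and "d \<ge> 2"
  shows
    "(Psi n d :: 'k::{alg_closed_field, field_char_0} vec set set set \<Rightarrow> 'k vec set set set)
        \<in> moduli n d \<rightarrow> moduli (n + 1) d \<and>
     (\<forall>F :: 'k mpoly. smooth_form (n + 1) d F \<longrightarrow>
        Psi n d (moduli_class n d (zero_locus (n + 1) F)) =
          moduli_class (n + 1) d (cyclic_cover n d F)) \<and>
     inj_on (Psi n d :: 'k vec set set set \<Rightarrow> 'k vec set set set) (moduli n d) \<and>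
     (\<forall>F1 F2 :: 'k mpoly. smooth_form (n + 1) d F1 \<longrightarrow> smooth_form (n + 1) d F2 \<longrightarrow>
        proj_equivalent (n + 2) (cyclic_cover n d F1) (cyclic_cover n d F2) \<longrightarrow>
        proj_equivalent (n + 1) (zero_locus (n + 1) F1) (zero_locus (n + 1) F2))"
proof -
  have "d > 0"
    using \<open>d \<ge> 2\<close> by simp
  note equiv = equiv_moduli_rel[OF this]
  \<comment> \<open>Writing \<open>n + 2\<close> as \<open>n + 1 + 1\<close> matches the cover
    lemmas with \<open>m = n + 1\<close>.\<close>
  have cover_eq: "cyclic_cover n d F = zero_locus (n + 1 + 1) (mvar (n + 1 + 1) ^ d - F)" for F :: "'k mpoly"
    by (simp add: cyclic_cover_def)
  have locus: "zero_locus (n + 1) F \<in> smooth_hypersurfaces (n + 1) d"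
    if "smooth_form (n + 1) d F" for F :: "'k mpoly"
    using that by (auto simp: smooth_hypersurfaces_def)
  have cover: "cyclic_cover n d F \<in> smooth_hypersurfaces (n + 1 + 1) d"
    if "smooth_form (n + 1) d F" for F :: "'k mpoly"
    using smooth_cover[OF that \<open>d > 0\<close>] unfolding cover_eq smooth_hypersurfaces_def by blast
  have injective: "proj_equivalent (n + 1) (zero_locus (n + 1) F1) (zero_locus (n + 1) F2)"
    if "smooth_form (n + 1) d F1" "smooth_form (n + 1) d F2"
      "proj_equivalent (n + 2) (cyclic_cover n d F1) (cyclic_cover n d F2)" for F1 F2 :: "'k mpoly"
    using forms_equivalent_if_covers_equivalent[OF that(1,2) \<open>d \<ge> 2\<close>] that(3)
    unfolding cover_eq by simp
  have Psi_eq: "Psi n d (moduli_class n d (zero_locus (n + 1) F)) = moduli_class (n + 1) d (cyclic_cover n d F)"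
    if F: "smooth_form (n + 1) d F" for F :: "'k mpoly"
  proof -
    \<comment> \<open>All classes in the union defining \<open>Psi\<close> agree; as
      \<open>F\<close> itself contributes one, the union equals that class.\<close>
    have "moduli_class (n + 1) d (cyclic_cover n d G) = moduli_class (n + 1) d (cyclic_cover n d F)"
      if G: "smooth_form (n + 1) d G" "zero_locus (n + 1) G \<in> moduli_class n d (zero_locus (n + 1) F)" for G
    proof -
      have "proj_equivalent (n + 1) (zero_locus (n + 1) F) (zero_locus (n + 1) G)"
        using G(2) by (simp add: moduli_class_def moduli_rel_def)
      from cover_equivalent[OF F G(1) \<open>d > 0\<close> this]
      have "(cyclic_cover n d F, cyclic_cover n d G) \<in> moduli_rel (n + 1) d"
        using cover[OF F] cover[OF G(1)] unfolding cover_eq moduli_rel_def by blast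
      then show ?thesis
        using equiv_class_eq[OF equiv] unfolding moduli_class_def by blast
    qed
    moreover have "zero_locus (n + 1) F \<in> moduli_class n d (zero_locus (n + 1) F)"
      using equiv_class_self[OF equiv locus[OF F]] by (simp add: moduli_class_def)
    ultimately show ?thesis
      using F unfolding Psi_def by blast
  qed
  have moduliE: "\<exists>F. smooth_form (n + 1) d F \<and> C = moduli_class n d (zero_locus (n + 1) F)"
    if "C \<in> moduli n d" for C :: "'k vec set set set"
    using that unfolding moduli_def moduli_class_def quotient_def smooth_hypersurfaces_def by blast
  have "Psi n d C \<in> moduli (n + 1) d" if C: "C \<in> moduli n d" for C :: "'k vec set set set"
  proof -
    obtain F where F: "smooth_form (n + 1) d F" "C = moduli_class n d (zero_locus (n + 1) F)"
      using moduliE[OF C] by blast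
    show ?thesis
      unfolding F(2) Psi_eq[OF F(1)] unfolding moduli_def moduli_class_def by (rule quotientI[OF cover[OF F(1)]])
  qed
  moreover have "inj_on (Psi n d :: 'k vec set set set \<Rightarrow> 'k vec set set set) (moduli n d)"
  proof (rule inj_onI)
    fix C1 C2 :: "'k vec set set set"
    assume C: "C1 \<in> moduli n d" "C2 \<in> moduli n d" "Psi n d C1 = Psi n d C2"
    obtain F1 where F1: "smooth_form (n + 1) d F1" "C1 = moduli_class n d (zero_locus (n + 1) F1)"
      using moduliE[OF C(1)] by blast
    obtain F2 where F2: "smooth_form (n + 1) d F2" "C2 = moduli_class n d (zero_locus (n + 1) F2)"
      using moduliE[OF C(2)] by blast
    have "moduli_class (n + 1) d (cyclic_cover n d F1) = moduli_class (n + 1) d (cyclic_cover n d F2)"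
      using C(3) unfolding F1(2) F2(2) Psi_eq[OF F1(1)] Psi_eq[OF F2(1)] .
    then have "(cyclic_cover n d F1, cyclic_cover n d F2) \<in> moduli_rel (n + 1) d"
      using eq_equiv_class[OF _ equiv cover[OF F2(1)]] unfolding moduli_class_def by blast
    then have "proj_equivalent (n + 1) (zero_locus (n + 1) F1) (zero_locus (n + 1) F2)"
      by (intro injective[OF F1(1) F2(1)]) (simp add: moduli_rel_def)
    then have "(zero_locus (n + 1) F1, zero_locus (n + 1) F2) \<in> moduli_rel n d"
      using locus[OF F1(1)] locus[OF F2(1)] by (simp add: moduli_rel_def)
    then show "C1 = C2"
      unfolding F1(2) F2(2) moduli_class_def by (rule equiv_class_eq[OF equiv])
  qed
  ultimately show ?thesis
    using Psi_eq injective by blast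
qed

end
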